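(* Every wide finitely generated group that has undistorted elements (i.e. contains an undistorted element) belongs to $\mathcal{G}_H$.
   Context: A finitely generated group is wide if none of its asymptotic cones has a cut-point, where a (global) cut-point of a connected, locally connected space $X$ is a point $x$ such that $X\setminus\{x\}$ has at least two connected components. For a finitely generated group $G$ fix a finite symmetric generating set $S$ with word length $\ell_S$, and let $B(n)=\{g\in G:\ell_S(g)\le n\}$. An element $g\in G$ of infinite order is undistorted if $\lim_{n\to\infty}\ell_S(g^n)/n>0$ (independent of $S$). For a finite (discrete) set $A$, $G$ acts on $A^G$ (product topology) by $(gx)_h=x_{g^{-1}h}$. $\mathscr{G}_{inv}$ is the class of Polish groups admitting a compatible bi-invariant metric; for $H\in\mathscr{G}_{inv}$ fix such a (complete) metric $d$. A map $f:A^G\to H$ is H\"older continuous if there are $C>0$, $0<r<1$ such that for every $n\ge0$, $d(f(x),f(y))\le Cr^n$ for all $x,y$ with $x_{B(n)}=y_{B(n)}$. A cocycle $c:G\times A^G\to H$ is a map with $c(gh,x)=c(g,hx)c(h,x)$; it is H\"older continuous if $c(g,\cdot)$ is H\"older continuous for each $g$. Cocycles $c_1,c_2$ are H\"older cohomologous if there is a H\"older continuous $b:A^G\to H$ with $c_1(g,x)=b(gx)^{-1}c_2(g,x)b(x)$ for all $g,x$. $\mathcal{G}_H$ is the class of groups $G$ such that for every finite set $A$ and every $H\in\mathscr{G}_{inv}$, every H\"older continuous cocycle $c:G\times A^G\to H$ is H\"older cohomologous to a group homomorphism $G\to H$. *)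

theory Defs
  imports "HOL-Analysis.Analysis" "HOL-Algebra.Multiplicative_Group"
begin

section \<open>Word metrics\<close>

definition finite_symmetric_generating_set :: "('g, 'm) monoid_scheme \<Rightarrow> 'g set \<Rightarrow> bool" where
  "finite_symmetric_generating_set G S \<longleftrightarrow>
     finite S \<and> S \<subseteq> carrier G \<and> (\<forall>s\<in>S. inv\<^bsub>G\<^esub> s \<in> S) \<and> generate G S = carrier G"

definition word_value :: "('g, 'm) monoid_scheme \<Rightarrow> 'g list \<Rightarrow> 'g" where
  "word_value G ws = foldr (\<otimes>\<^bsub>G\<^esub>) ws \<one>\<^bsub>G\<^esub>"

definition word_length :: "('g, 'm) monoid_scheme \<Rightarrow> 'g set \<Rightarrow> 'g \<Rightarrow> nat" where
  "word_length G S g = (LEAST n. \<exists>ws. length ws = n \<and> set ws \<subseteq> S \<and> word_value G ws = g)"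

definition word_ball :: "('g, 'm) monoid_scheme \<Rightarrow> 'g set \<Rightarrow> nat \<Rightarrow> 'g set" where
  "word_ball G S n = {g \<in> carrier G. word_length G S g \<le> n}"

text \<open>The locale \<^locale>\<open>Metric_space\<close> asks for symmetry and nonnegativity on the whole type,
  whence the default value 0 off the carrier (here and for the cone below).\<close>

definition word_dist :: "('g, 'm) monoid_scheme \<Rightarrow> 'g set \<Rightarrow> 'g \<Rightarrow> 'g \<Rightarrow> real" where
  "word_dist G S g h =
     (if g \<in> carrier G \<and> h \<in> carrier G then real (word_length G S (inv\<^bsub>G\<^esub> g \<otimes>\<^bsub>G\<^esub> h)) else 0)"

definition undistorted :: "('g, 'm) monoid_scheme \<Rightarrow> 'g set \<Rightarrow> 'g \<Rightarrow> bool" where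
  "undistorted G S g \<longleftrightarrow>
     (\<forall>n::nat. 0 < n \<longrightarrow> g [^]\<^bsub>G\<^esub> n \<noteq> \<one>\<^bsub>G\<^esub>) \<and>
     (\<exists>L>0. (\<lambda>n::nat. real (word_length G S (g [^]\<^bsub>G\<^esub> n)) / real n) \<longlonglongrightarrow> L)"


section \<open>Asymptotic cones\<close>

definition nonprincipal_ultrafilter :: "'i filter \<Rightarrow> bool" where
  "nonprincipal_ultrafilter \<omega> \<longleftrightarrow>
     \<omega> \<noteq> bot \<and>
     (\<forall>P. eventually P \<omega> \<or> eventually (\<lambda>i. \<not> P i) \<omega>) \<and>
     (\<forall>j. \<not> eventually (\<lambda>i. i = j) \<omega>)"

text \<open>The cone of \<open>(M, d)\<close> along \<open>\<omega>\<close>, with observation points \<open>e\<close> and scaling constants \<open>s\<close>,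
  is the set of sequences \<open>x\<close> for which the rescaled distances to \<open>e\<close> are bounded along \<open>\<omega>\<close>,
  modulo ultralimit distance 0.\<close>

definition ulim_dist ::
  "('p \<Rightarrow> 'p \<Rightarrow> real) \<Rightarrow> nat filter \<Rightarrow> (nat \<Rightarrow> real) \<Rightarrow> (nat \<Rightarrow> 'p) \<Rightarrow> (nat \<Rightarrow> 'p) \<Rightarrow> real" where
  "ulim_dist d \<omega> s x y = Lim \<omega> (\<lambda>n. d (x n) (y n) / s n)"

definition cone_seqs ::
  "'p set \<Rightarrow> ('p \<Rightarrow> 'p \<Rightarrow> real) \<Rightarrow> nat filter \<Rightarrow> (nat \<Rightarrow> 'p) \<Rightarrow> (nat \<Rightarrow> real) \<Rightarrow> (nat \<Rightarrow> 'p) set" where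
  "cone_seqs M d \<omega> e s =
     {x. (\<forall>n. x n \<in> M) \<and> (\<exists>B. eventually (\<lambda>n. d (e n) (x n) / s n \<le> B) \<omega>)}"

definition cone_rel ::
  "'p set \<Rightarrow> ('p \<Rightarrow> 'p \<Rightarrow> real) \<Rightarrow> nat filter \<Rightarrow> (nat \<Rightarrow> 'p) \<Rightarrow> (nat \<Rightarrow> real) \<Rightarrow> (nat \<Rightarrow> 'p) rel" where
  "cone_rel M d \<omega> e s =
     {(x, y). x \<in> cone_seqs M d \<omega> e s \<and> y \<in> cone_seqs M d \<omega> e s \<and> ulim_dist d \<omega> s x y = 0}"

definition cone_points ::
  "'p set \<Rightarrow> ('p \<Rightarrow> 'p \<Rightarrow> real) \<Rightarrow> nat filter \<Rightarrow> (nat \<Rightarrow> 'p) \<Rightarrow> (nat \<Rightarrow> real) \<Rightarrow> (nat \<Rightarrow> 'p) set set" where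
  "cone_points M d \<omega> e s = cone_seqs M d \<omega> e s // cone_rel M d \<omega> e s"

definition cone_dist ::
  "'p set \<Rightarrow> ('p \<Rightarrow> 'p \<Rightarrow> real) \<Rightarrow> nat filter \<Rightarrow> (nat \<Rightarrow> 'p) \<Rightarrow> (nat \<Rightarrow> real)
     \<Rightarrow> (nat \<Rightarrow> 'p) set \<Rightarrow> (nat \<Rightarrow> 'p) set \<Rightarrow> real" where
  "cone_dist M d \<omega> e s X Y =
     (if X \<in> cone_points M d \<omega> e s \<and> Y \<in> cone_points M d \<omega> e s
      then ulim_dist d \<omega> s (SOME x. x \<in> X) (SOME y. y \<in> Y) else 0)"

definition asymptotic_cone ::
  "'p set \<Rightarrow> ('p \<Rightarrow> 'p \<Rightarrow> real) \<Rightarrow> nat filter \<Rightarrow> (nat \<Rightarrow> 'p) \<Rightarrow> (nat \<Rightarrow> real)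
     \<Rightarrow> (nat \<Rightarrow> 'p) set topology" where
  "asymptotic_cone M d \<omega> e s =
     Metric_space.mtopology (cone_points M d \<omega> e s) (cone_dist M d \<omega> e s)"

definition cut_point :: "'p topology \<Rightarrow> 'p \<Rightarrow> bool" where
  "cut_point X p \<longleftrightarrow>
     connected_space X \<and> locally_connected_space X \<and> p \<in> topspace X \<and>
     (\<exists>C D. C \<in> connected_components_of (subtopology X (topspace X - {p})) \<and>
            D \<in> connected_components_of (subtopology X (topspace X - {p})) \<and> C \<noteq> D)"

definition wide :: "('g, 'm) monoid_scheme \<Rightarrow> 'g set \<Rightarrow> bool" where
  "wide G S \<longleftrightarrow>
     (\<forall>\<omega> e s. nonprincipal_ultrafilter \<omega> \<and> (\<forall>n. e n \<in> carrier G) \<and>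
              (\<forall>n. 0 < s n) \<and> filterlim s at_top \<omega> \<longrightarrow>
        (\<nexists>p. cut_point (asymptotic_cone (carrier G) (word_dist G S) \<omega> e s) p))"


section \<open>Word metrics and cones are metric spaces\<close>

locale word_data = group G for G :: "('g, 'm) monoid_scheme" (structure) +
  fixes S :: "'g set"
  assumes gens: "finite_symmetric_generating_set G S"
begin

lemma word_value_simps [simp]:
  "word_value G [] = \<one>" "word_value G (a # ws) = a \<otimes> word_value G ws"
  by (simp_all add: word_value_def)

lemma S_carrier: "set ws \<subseteq> S \<Longrightarrow> set ws \<subseteq> carrier G"
  using gens by (auto simp: finite_symmetric_generating_set_def)

lemma word_value_closed [simp]: "set ws \<subseteq> carrier G \<Longrightarrow> word_value G ws \<in> carrier G"
  by (induction ws) auto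

lemma word_value_append:
  "\<lbrakk>set us \<subseteq> carrier G; set ws \<subseteq> carrier G\<rbrakk>
   \<Longrightarrow> word_value G (us @ ws) = word_value G us \<otimes> word_value G ws"
  by (induction us) (auto simp: m_assoc)

lemma word_value_inv:
  "set ws \<subseteq> carrier G \<Longrightarrow> word_value G (rev (map (m_inv G) ws)) = inv (word_value G ws)"
proof (induction ws)
  case (Cons a ws)
  then have "set (rev (map (m_inv G) ws)) \<subseteq> carrier G" "set [inv a] \<subseteq> carrier G"
    by auto
  from word_value_append[OF this] Cons show ?case
    by (simp add: inv_mult_group)
qed simp

lemma ex_word: "g \<in> carrier G \<Longrightarrow> \<exists>ws. set ws \<subseteq> S \<and> word_value G ws = g"
proof -
  assume "g \<in> carrier G"
  then have "g \<in> generate G S"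
    using gens by (simp add: finite_symmetric_generating_set_def)
  then show ?thesis
  proof (induction rule: generate.induct)
    case one
    show ?case by (intro exI[of _ "[]"]) auto
  next
    case (incl h)
    then have "h \<in> carrier G" using S_carrier[of "[h]"] by simp
    then show ?case using incl by (intro exI[of _ "[h]"]) auto
  next
    case (inv h)
    then have "h \<in> carrier G" "inv h \<in> S"
      using gens by (auto simp: finite_symmetric_generating_set_def)
    then show ?case by (intro exI[of _ "[inv h]"]) auto
  next
    case (eng h1 h2)
    then obtain us ws where "set us \<subseteq> S" "word_value G us = h1" "set ws \<subseteq> S" "word_value G ws = h2"
      by blast
    then show ?case
      by (intro exI[of _ "us @ ws"]) (auto simp: word_value_append S_carrier)
  qed
qed

lemma word_length_witness:
  assumes "g \<in> carrier G"
  obtains ws where "length ws = word_length G S g" "set ws \<subseteq> S" "word_value G ws = g"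
proof -
  have "\<exists>ws. length ws = word_length G S g \<and> set ws \<subseteq> S \<and> word_value G ws = g"
    unfolding word_length_def by (rule LeastI_ex) (use ex_word[OF assms] in blast)
  then show ?thesis using that by blast
qed

lemma word_length_le: "set ws \<subseteq> S \<Longrightarrow> word_length G S (word_value G ws) \<le> length ws"
  unfolding word_length_def by (rule Least_le) blast

lemma word_length_inv_le:
  assumes "g \<in> carrier G" shows "word_length G S (inv g) \<le> word_length G S g"
proof -
  obtain ws where ws: "length ws = word_length G S g" "set ws \<subseteq> S" "word_value G ws = g"
    using word_length_witness[OF assms] .
  have "set (rev (map (m_inv G) ws)) \<subseteq> S"
    using ws(2) gens by (auto simp: finite_symmetric_generating_set_def)
  from word_length_le[OF this] show ?thesis
    using ws word_value_inv[OF S_carrier[OF ws(2)]] by simp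
qed

lemma word_length_inv: "g \<in> carrier G \<Longrightarrow> word_length G S (inv g) = word_length G S g"
  using word_length_inv_le[of g] word_length_inv_le[of "inv g"] by simp

lemma word_length_mult_le:
  assumes "g \<in> carrier G" "h \<in> carrier G"
  shows "word_length G S (g \<otimes> h) \<le> word_length G S g + word_length G S h"
proof -
  obtain us where us: "length us = word_length G S g" "set us \<subseteq> S" "word_value G us = g"
    using word_length_witness[OF assms(1)] .
  obtain ws where ws: "length ws = word_length G S h" "set ws \<subseteq> S" "word_value G ws = h"
    using word_length_witness[OF assms(2)] .
  show ?thesis
    using word_length_le[of "us @ ws"] us ws by (simp add: word_value_append S_carrier)
qed

lemma word_length_eq_0_iff: "g \<in> carrier G \<Longrightarrow> word_length G S g = 0 \<longleftrightarrow> g = \<one>"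
  using word_length_witness[of g] word_length_le[of "[]"] by force

lemma Metric_space_word_dist: "Metric_space (carrier G) (word_dist G S)"
proof
  fix x y
  show "0 \<le> word_dist G S x y" by (simp add: word_dist_def)
  show "word_dist G S x y = word_dist G S y x"
    using word_length_inv[of "inv x \<otimes> y"] by (auto simp: word_dist_def inv_mult_group)
next
  fix x y assume xy: "x \<in> carrier G" "y \<in> carrier G"
  then have "inv x \<otimes> y = \<one> \<longleftrightarrow> x = y"
    by (metis inv_closed inv_equality inv_inv l_inv)
  with xy show "word_dist G S x y = 0 \<longleftrightarrow> x = y"
    by (simp add: word_dist_def word_length_eq_0_iff)
next
  fix x y z assume xyz: "x \<in> carrier G" "y \<in> carrier G" "z \<in> carrier G"
  then have "inv x \<otimes> z = (inv x \<otimes> y) \<otimes> (inv y \<otimes> z)"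
    by (simp add: m_assoc flip: m_assoc[of y "inv y" z])
  with xyz word_length_mult_le[of "inv x \<otimes> y" "inv y \<otimes> z"]
  show "word_dist G S x z \<le> word_dist G S x y + word_dist G S y z"
    by (simp add: word_dist_def)
qed

end

lemma ultrafilter_convergent:
  fixes f :: "'i \<Rightarrow> real"
  assumes u: "nonprincipal_ultrafilter \<omega>" and b: "eventually (\<lambda>i. f i \<in> {a..b}) \<omega>"
  shows "\<exists>l. (f \<longlongrightarrow> l) \<omega>"
proof -
  have "filtermap f \<omega> \<noteq> bot" "eventually (\<lambda>x. x \<in> {a..b}) (filtermap f \<omega>)"
    using u b by (auto simp: nonprincipal_ultrafilter_def filtermap_bot_iff eventually_filtermap)
  then obtain l where l: "inf (nhds l) (filtermap f \<omega>) \<noteq> bot"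
    using compact_filter[of "{a..b}"] by auto
  have "eventually (\<lambda>i. P (f i)) \<omega>" if P: "eventually P (nhds l)" for P
  proof (rule ccontr)
    assume "\<not> eventually (\<lambda>i. P (f i)) \<omega>"
    then have "eventually (\<lambda>i. \<not> P (f i)) \<omega>"
      using u by (auto simp: nonprincipal_ultrafilter_def)
    then have "eventually (\<lambda>x. \<not> P x) (filtermap f \<omega>)"
      by (simp add: eventually_filtermap)
    with P have "eventually (\<lambda>x. False) (inf (nhds l) (filtermap f \<omega>))"
      unfolding eventually_inf by blast
    with l show False by (simp add: eventually_False)
  qed
  then have "(f \<longlongrightarrow> l) \<omega>"
    by (auto simp: filterlim_iff)
  then show ?thesis ..
qed

locale cone_data = Metric_space M d for M :: "'p set" and d +
  fixes \<omega> :: "nat filter" and e :: "nat \<Rightarrow> 'p" and s :: "nat \<Rightarrow> real"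
  assumes ultra: "nonprincipal_ultrafilter \<omega>"
    and base: "\<And>n. e n \<in> M"
    and scale: "\<And>n. 0 < s n"
begin

lemma nontriv: "\<omega> \<noteq> bot"
  using ultra by (simp add: nonprincipal_ultrafilter_def)

lemma ulim_dist_tendsto:
  assumes x: "x \<in> cone_seqs M d \<omega> e s" and y: "y \<in> cone_seqs M d \<omega> e s"
  shows "((\<lambda>n. d (x n) (y n) / s n) \<longlongrightarrow> ulim_dist d \<omega> s x y) \<omega>"
proof -
  obtain B where B: "eventually (\<lambda>n. d (e n) (x n) / s n \<le> B) \<omega>"
    using x by (auto simp: cone_seqs_def)
  obtain B' where B': "eventually (\<lambda>n. d (e n) (y n) / s n \<le> B') \<omega>"
    using y by (auto simp: cone_seqs_def)
  have "eventually (\<lambda>n. d (x n) (y n) / s n \<in> {0..B + B'}) \<omega>"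
    using B B'
  proof eventually_elim
    case (elim n)
    have "d (x n) (y n) \<le> d (e n) (x n) + d (e n) (y n)"
      using triangle[of "x n" "e n" "y n"] x y base[of n] commute[of "x n" "e n"]
      by (simp add: cone_seqs_def)
    then have "d (x n) (y n) / s n \<le> d (e n) (x n) / s n + d (e n) (y n) / s n"
      using scale[of n] by (simp add: divide_simps)
    with elim show ?case
      using scale[of n] by simp
  qed
  from ultrafilter_convergent[OF ultra this] obtain l
    where "((\<lambda>n. d (x n) (y n) / s n) \<longlongrightarrow> l) \<omega>" ..
  then show ?thesis
    using tendsto_Lim[OF nontriv, of "\<lambda>n. d (x n) (y n) / s n" l] by (simp add: ulim_dist_def)
qed

lemma ulim_dist_nonneg:
  assumes "x \<in> cone_seqs M d \<omega> e s" "y \<in> cone_seqs M d \<omega> e s"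
  shows "0 \<le> ulim_dist d \<omega> s x y"
  by (rule tendsto_lowerbound[OF ulim_dist_tendsto[OF assms] _ nontriv])
     (use scale in \<open>auto intro!: always_eventually divide_nonneg_pos\<close>)

lemma ulim_dist_commute: "ulim_dist d \<omega> s x y = ulim_dist d \<omega> s y x"
  by (simp add: ulim_dist_def commute)

lemma ulim_dist_triangle:
  assumes x: "x \<in> cone_seqs M d \<omega> e s" and y: "y \<in> cone_seqs M d \<omega> e s"
    and z: "z \<in> cone_seqs M d \<omega> e s"
  shows "ulim_dist d \<omega> s x z \<le> ulim_dist d \<omega> s x y + ulim_dist d \<omega> s y z"
proof (rule tendsto_le[OF nontriv tendsto_add[OF ulim_dist_tendsto[OF x y] ulim_dist_tendsto[OF y z]]
        ulim_dist_tendsto[OF x z]])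
  show "eventually (\<lambda>n. d (x n) (z n) / s n \<le> d (x n) (y n) / s n + d (y n) (z n) / s n) \<omega>"
  proof (rule always_eventually, rule allI)
    fix n
    have "d (x n) (z n) \<le> d (x n) (y n) + d (y n) (z n)"
      using triangle x y z by (simp add: cone_seqs_def)
    then show "d (x n) (z n) / s n \<le> d (x n) (y n) / s n + d (y n) (z n) / s n"
      using scale[of n] by (simp add: divide_simps)
  qed
qed

lemma ulim_dist_refl: "x \<in> cone_seqs M d \<omega> e s \<Longrightarrow> ulim_dist d \<omega> s x x = 0"
  using tendsto_Lim[OF nontriv tendsto_const[of 0]] by (simp add: ulim_dist_def cone_seqs_def)

lemma equiv_cone_rel: "equiv (cone_seqs M d \<omega> e s) (cone_rel M d \<omega> e s)"
proof (rule equivI)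
  show "cone_rel M d \<omega> e s \<subseteq> cone_seqs M d \<omega> e s \<times> cone_seqs M d \<omega> e s"
    by (auto simp: cone_rel_def)
  show "refl_on (cone_seqs M d \<omega> e s) (cone_rel M d \<omega> e s)"
    by (auto simp: refl_on_def cone_rel_def ulim_dist_refl)
  show "sym (cone_rel M d \<omega> e s)"
    by (auto simp: sym_def cone_rel_def ulim_dist_commute)
  show "trans (cone_rel M d \<omega> e s)"
    unfolding trans_def cone_rel_def
    using ulim_dist_triangle ulim_dist_nonneg by fastforce
qed

lemma rep_in:
  assumes "X \<in> cone_points M d \<omega> e s"
  shows "(SOME x. x \<in> X) \<in> X" "X \<subseteq> cone_seqs M d \<omega> e s"
  using assms in_quotient_imp_non_empty[OF equiv_cone_rel]
    in_quotient_imp_subset[OF equiv_cone_rel]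
  by (auto simp: cone_points_def some_in_eq)

lemma ulim_dist_cong:
  assumes "(x, x') \<in> cone_rel M d \<omega> e s" "(y, y') \<in> cone_rel M d \<omega> e s"
  shows "ulim_dist d \<omega> s x y = ulim_dist d \<omega> s x' y'"
proof -
  have *: "ulim_dist d \<omega> s u v \<le> ulim_dist d \<omega> s u' v'"
    if "(u, u') \<in> cone_rel M d \<omega> e s" "(v, v') \<in> cone_rel M d \<omega> e s" for u u' v v'
    using that ulim_dist_triangle[of u u' v] ulim_dist_triangle[of u' v' v]
      ulim_dist_commute[of v v']
    by (auto simp: cone_rel_def)
  have "(x', x) \<in> cone_rel M d \<omega> e s" "(y', y) \<in> cone_rel M d \<omega> e s"
    using assms equiv_cone_rel by (auto dest: equivE symD)
  with *[of x x' y y'] *[of x' x y' y] assms show ?thesis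
    by force
qed

lemma cone_dist_eq:
  assumes X: "X \<in> cone_points M d \<omega> e s" and Y: "Y \<in> cone_points M d \<omega> e s"
    and "x \<in> X" "y \<in> Y"
  shows "cone_dist M d \<omega> e s X Y = ulim_dist d \<omega> s x y"
proof -
  have "((SOME x. x \<in> X), x) \<in> cone_rel M d \<omega> e s" "((SOME y. y \<in> Y), y) \<in> cone_rel M d \<omega> e s"
    using quotient_eq_iff[OF equiv_cone_rel] assms rep_in[OF X] rep_in[OF Y]
    by (auto simp: cone_points_def)
  from ulim_dist_cong[OF this] show ?thesis
    using X Y by (simp add: cone_dist_def)
qed

lemma Metric_space_cone: "Metric_space (cone_points M d \<omega> e s) (cone_dist M d \<omega> e s)"
proof
  fix X Y
  show "0 \<le> cone_dist M d \<omega> e s X Y"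
    using rep_in[of X] rep_in[of Y] ulim_dist_nonneg by (auto simp: cone_dist_def)
  show "cone_dist M d \<omega> e s X Y = cone_dist M d \<omega> e s Y X"
    by (simp add: cone_dist_def ulim_dist_commute)
next
  fix X Y
  assume X: "X \<in> cone_points M d \<omega> e s" and Y: "Y \<in> cone_points M d \<omega> e s"
  let ?x = "SOME x. x \<in> X" and ?y = "SOME y. y \<in> Y"
  have "X = Y \<longleftrightarrow> (?x, ?y) \<in> cone_rel M d \<omega> e s"
    using quotient_eq_iff[OF equiv_cone_rel] rep_in[OF X] rep_in[OF Y] X Y
    by (simp add: cone_points_def)
  also have "\<dots> \<longleftrightarrow> ulim_dist d \<omega> s ?x ?y = 0"
    using rep_in[OF X] rep_in[OF Y] by (auto simp: cone_rel_def)
  finally show "cone_dist M d \<omega> e s X Y = 0 \<longleftrightarrow> X = Y"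
    using X Y by (simp add: cone_dist_def)
next
  fix X Y Z
  assume "X \<in> cone_points M d \<omega> e s" "Y \<in> cone_points M d \<omega> e s" "Z \<in> cone_points M d \<omega> e s"
  then show "cone_dist M d \<omega> e s X Z \<le> cone_dist M d \<omega> e s X Y + cone_dist M d \<omega> e s Y Z"
    using rep_in[of X] rep_in[of Y] rep_in[of Z] ulim_dist_triangle
    by (simp add: cone_dist_def subset_iff)
qed

end


section \<open>Polish groups with a bi-invariant metric\<close>

definition polish_group :: "('h, 'k) monoid_scheme \<Rightarrow> 'h topology \<Rightarrow> bool" where
  "polish_group H T \<longleftrightarrow>
     group H \<and> topspace T = carrier H \<and>
     continuous_map (prod_topology T T) T (\<lambda>(x, y). x \<otimes>\<^bsub>H\<^esub> y) \<and>
     continuous_map T T (\<lambda>x. inv\<^bsub>H\<^esub> x) \<and>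
     completely_metrizable_space T \<and> separable_space T"

definition compatible_biinvariant_metric ::
  "('h, 'k) monoid_scheme \<Rightarrow> 'h topology \<Rightarrow> ('h \<Rightarrow> 'h \<Rightarrow> real) \<Rightarrow> bool" where
  "compatible_biinvariant_metric H T d \<longleftrightarrow>
     Metric_space (carrier H) d \<and> Metric_space.mtopology (carrier H) d = T \<and>
     (\<forall>a\<in>carrier H. \<forall>x\<in>carrier H. \<forall>y\<in>carrier H.
        d (a \<otimes>\<^bsub>H\<^esub> x) (a \<otimes>\<^bsub>H\<^esub> y) = d x y \<and> d (x \<otimes>\<^bsub>H\<^esub> a) (y \<otimes>\<^bsub>H\<^esub> a) = d x y)"


section \<open>Cocycles over full shifts\<close>

definition full_shift :: "('g, 'm) monoid_scheme \<Rightarrow> 'a set \<Rightarrow> ('g \<Rightarrow> 'a) set" where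
  "full_shift G A = (carrier G \<rightarrow>\<^sub>E A)"

definition shift :: "('g, 'm) monoid_scheme \<Rightarrow> 'g \<Rightarrow> ('g \<Rightarrow> 'a) \<Rightarrow> ('g \<Rightarrow> 'a)" where
  "shift G g x = restrict (\<lambda>h. x (inv\<^bsub>G\<^esub> g \<otimes>\<^bsub>G\<^esub> h)) (carrier G)"

definition hoelder_continuous ::
  "('g, 'm) monoid_scheme \<Rightarrow> 'g set \<Rightarrow> 'a set \<Rightarrow> ('h \<Rightarrow> 'h \<Rightarrow> real) \<Rightarrow> (('g \<Rightarrow> 'a) \<Rightarrow> 'h) \<Rightarrow> bool" where
  "hoelder_continuous G S A d f \<longleftrightarrow>
     (\<exists>C r::real. 0 < C \<and> 0 < r \<and> r < 1 \<and>
        (\<forall>n::nat. \<forall>x\<in>full_shift G A. \<forall>y\<in>full_shift G A.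
           (\<forall>h\<in>word_ball G S n. x h = y h) \<longrightarrow> d (f x) (f y) \<le> C * r ^ n))"

definition cocycle ::
  "('g, 'm) monoid_scheme \<Rightarrow> 'a set \<Rightarrow> ('h, 'k) monoid_scheme \<Rightarrow> ('g \<Rightarrow> ('g \<Rightarrow> 'a) \<Rightarrow> 'h) \<Rightarrow> bool" where
  "cocycle G A H c \<longleftrightarrow>
     (\<forall>g\<in>carrier G. \<forall>x\<in>full_shift G A. c g x \<in> carrier H) \<and>
     (\<forall>g\<in>carrier G. \<forall>h\<in>carrier G. \<forall>x\<in>full_shift G A.
        c (g \<otimes>\<^bsub>G\<^esub> h) x = c g (shift G h x) \<otimes>\<^bsub>H\<^esub> c h x)"

definition hoelder_cocycle ::
  "('g, 'm) monoid_scheme \<Rightarrow> 'g set \<Rightarrow> 'a set \<Rightarrow> ('h, 'k) monoid_scheme \<Rightarrow> ('h \<Rightarrow> 'h \<Rightarrow> real)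
     \<Rightarrow> ('g \<Rightarrow> ('g \<Rightarrow> 'a) \<Rightarrow> 'h) \<Rightarrow> bool" where
  "hoelder_cocycle G S A H d c \<longleftrightarrow>
     cocycle G A H c \<and> (\<forall>g\<in>carrier G. hoelder_continuous G S A d (c g))"

definition hoelder_cohomologous ::
  "('g, 'm) monoid_scheme \<Rightarrow> 'g set \<Rightarrow> 'a set \<Rightarrow> ('h, 'k) monoid_scheme \<Rightarrow> ('h \<Rightarrow> 'h \<Rightarrow> real)
     \<Rightarrow> ('g \<Rightarrow> ('g \<Rightarrow> 'a) \<Rightarrow> 'h) \<Rightarrow> ('g \<Rightarrow> ('g \<Rightarrow> 'a) \<Rightarrow> 'h) \<Rightarrow> bool" where
  "hoelder_cohomologous G S A H d c1 c2 \<longleftrightarrow>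
     (\<exists>b. (\<forall>x\<in>full_shift G A. b x \<in> carrier H) \<and> hoelder_continuous G S A d b \<and>
          (\<forall>g\<in>carrier G. \<forall>x\<in>full_shift G A.
             c1 g x = inv\<^bsub>H\<^esub> (b (shift G g x)) \<otimes>\<^bsub>H\<^esub> c2 g x \<otimes>\<^bsub>H\<^esub> b x))"

text \<open>The alphabet \<open>A\<close> and the target \<open>H\<close> range over all sets and groups on the types \<open>'a\<close> and
  \<open>'h\<close>. HOL cannot quantify over types inside a definition, so these are parameters; a theorem that
  leaves them as type variables covers all alphabets and all targets. The metric \<open>d\<close> fixed on \<open>H\<close>
  is arbitrary.\<close>

definition hoelder_rigid_class ::
  "'a itself \<Rightarrow> 'h itself \<Rightarrow> ('g, 'm) monoid_scheme \<Rightarrow> 'g set \<Rightarrow> bool" where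
  "hoelder_rigid_class _ _ G S \<longleftrightarrow>
     (\<forall>(A :: 'a set) (H :: 'h monoid) T d c.
        finite A \<and> polish_group H T \<and>
        compatible_biinvariant_metric H T d \<and> Metric_space.mcomplete (carrier H) d \<and>
        hoelder_cocycle G S A H d c \<longrightarrow>
        (\<exists>\<phi>\<in>hom G H. hoelder_cohomologous G S A H d c (\<lambda>g x. \<phi> g)))"

end

theory Submission
  imports Defs "HOL-Real_Asymp.Real_Asymp"
begin

text \<open>
  Let \<open>x0\<close> be a constant configuration and \<open>\<phi> h = c h x0\<close>, which is a homomorphism since \<open>x0\<close> is a
  fixed point. For \<open>x\<close> that differs from \<open>x0\<close> at finitely many places, the transfer function is
  \<open>b x = lim (c u x0)\<^sup>-\<^sup>1 c u x\<close> for \<open>u\<close> running through the positive powers of an undistorted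
  element \<open>g\<close>: there the increments decay geometrically. As a function of \<open>u\<^sup>-\<^sup>1\<close>, the expression
  under the limit changes exponentially little far away from the identity. Hence it induces on the
  asymptotic cone, minus its base point, an equivalence relation with open classes; since the base
  point is not a cut point, there is only one class. So all sequences \<open>u\<close> of linear growth give the
  same limit along an ultrafilter. Comparing \<open>g\<^sup>n\<close> with \<open>g\<^sup>n h\<close> yields the cohomology equation, and
  comparing \<open>g\<^sup>n\<close> with \<open>g\<^sup>-\<^sup>n\<close> yields the Hoelder estimate for \<open>b\<close>, which then extends to all
  configurations by density.
\<close>

section \<open>Nonprincipal ultrafilters on the natural numbers\<close>

text \<open>Zorn's lemma on the proper filters below \<open>sequentially\<close>, with the order
  reversed. A finest such filter decides every predicate, and being below
  \<open>sequentially\<close> it concentrates on no single index.\<close>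

lemma ex_nonprincipal_ultrafilter: "\<exists>\<omega> :: nat filter. nonprincipal_ultrafilter \<omega>"
proof -
  let ?A = "{F :: nat filter. F \<noteq> bot \<and> F \<le> sequentially}"
  have "\<exists>m\<in>?A. \<forall>F\<in>?A. F \<le> m \<longrightarrow> F = m"
  proof (rule predicate_Zorn[where P = "\<lambda>F G. G \<le> F"])
    show "partial_order_on ?A (relation_of (\<lambda>F G. G \<le> F) ?A)"
      by (rule partial_order_on_relation_ofI) auto
    fix C assume C: "C \<in> Chains (relation_of (\<lambda>F G. G \<le> F) ?A)"
    then have CA: "C \<subseteq> ?A"
      by (auto simp: Chains_def relation_of_def)
    show "\<exists>u\<in>?A. \<forall>F\<in>C. u \<le> F"
    proof (cases "C = {}")
      case True
      then show ?thesis by (intro bexI[of _ sequentially]) auto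
    next
      case False
      \<comment> \<open>In a chain any two filters have a finer one in the chain, so the infimum is
        simply the union of its members' eventualities. Hence it stays proper.\<close>
      have "eventually P (Inf C) \<longleftrightarrow> (\<exists>F\<in>C. eventually P F)" for P
      proof (rule eventually_Inf_base[OF False])
        fix F F' assume "F \<in> C" "F' \<in> C"
        then have "F \<le> F' \<or> F' \<le> F"
          using C by (auto simp: Chains_def relation_of_def)
        then show "\<exists>x\<in>C. x \<le> inf F F'"
          using \<open>F \<in> C\<close> \<open>F' \<in> C\<close> by (metis inf.absorb1 inf.absorb2 order_refl)
      qed
      then have "Inf C \<noteq> bot"
        using CA by (auto simp: trivial_limit_def)
      moreover have "Inf C \<le> sequentially"
        using False CA by (auto intro: Inf_lower2)
      ultimately show ?thesis
        by (intro bexI[of _ "Inf C"]) (auto intro: Inf_lower)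
    qed
  qed
  then obtain m :: "nat filter" where m: "m \<noteq> bot" "m \<le> sequentially"
    and min: "\<And>F. F \<noteq> bot \<Longrightarrow> F \<le> m \<Longrightarrow> F = m"
    by (metis (mono_tags, lifting) mem_Collect_eq order_trans)
  have "eventually P m \<or> eventually (\<lambda>i. \<not> P i) m" for P
  proof (rule disjCI)
    assume *: "\<not> eventually (\<lambda>i. \<not> P i) m"
    \<comment> \<open>Restricting \<open>m\<close> to \<open>P\<close> stays proper because the
      negation of \<open>P\<close> is not eventual; minimality then shows that nothing was gained,
      so \<open>m\<close> already contained \<open>P\<close>.\<close>
    let ?F = "inf m (principal {i. P i})"
    have "?F \<noteq> bot"
      using * by (auto simp: trivial_limit_def eventually_inf_principal)
    then have "?F = m" by (intro min) auto
    moreover have "eventually P ?F"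
      by (auto simp: eventually_inf_principal)
    ultimately show "eventually P m" by simp
  qed
  moreover have "\<not> eventually (\<lambda>i. i = j) m" for j
  proof
    assume "eventually (\<lambda>i. i = j) m"
    moreover have "eventually (\<lambda>i. i > j) m"
      using m(2) eventually_gt_at_top filter_leD by blast
    ultimately have "eventually (\<lambda>i. False) m"
      by eventually_elim auto
    then show False using m(1) by (simp add: trivial_limit_def)
  qed
  ultimately show ?thesis
    using m(1) unfolding nonprincipal_ultrafilter_def by blast
qed

lemma nonprincipal_ultrafilter_le_sequentially:
  assumes "nonprincipal_ultrafilter \<omega>"
  shows "\<omega> \<le> sequentially"
proof -
  have "eventually (\<lambda>n. N \<le> n) \<omega>" for N :: nat
  proof -
    have "eventually (\<lambda>n. \<forall>j\<in>{..<N}. n \<noteq> j) \<omega>"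
      using assms by (intro eventually_ball_finite) (auto simp: nonprincipal_ultrafilter_def)
    then show ?thesis
      by eventually_elim (metis lessThan_iff not_le)
  qed
  then show ?thesis
    unfolding le_filter_def eventually_sequentially by (meson eventually_mono)
qed

section \<open>Cones of word metrics\<close>

context word_data
begin

lemma word_dist_mult:
  "\<lbrakk>p \<in> carrier G; v \<in> carrier G\<rbrakk> \<Longrightarrow> word_dist G S p (p \<otimes> v) = word_length G S v"
  by (simp add: word_dist_def flip: m_assoc)

lemma word_dist_one: "p \<in> carrier G \<Longrightarrow> word_dist G S \<one> p = word_length G S p"
  by (simp add: word_dist_def)

end

text \<open>\<open>\<Delta>\<close> is a pseudometric whose increments along edges of the Cayley
  graph decay exponentially outside a ball. It will be the distance in \<open>H\<close> between the
  values of \<open>E x\<close> at the inverses of \<open>p\<close> and \<open>q\<close>; inverting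
  turns left multiplication, to which the cocycle identity applies, into a step along an
  edge.\<close>

locale slow_distance = word_data G S for G :: "('g, 'm) monoid_scheme" (structure) and S +
  fixes \<Delta> :: "'g \<Rightarrow> 'g \<Rightarrow> real" and C r :: real and R :: nat
  assumes \<Delta>_triangle: "\<And>p q u. \<lbrakk>p \<in> carrier G; q \<in> carrier G; u \<in> carrier G\<rbrakk> \<Longrightarrow> \<Delta> p u \<le> \<Delta> p q + \<Delta> q u"
    and \<Delta>_commute: "\<And>p q. \<lbrakk>p \<in> carrier G; q \<in> carrier G\<rbrakk> \<Longrightarrow> \<Delta> p q = \<Delta> q p"
    and \<Delta>_refl: "\<And>p. p \<in> carrier G \<Longrightarrow> \<Delta> p p = 0"
    and slow: "\<And>p a. \<lbrakk>p \<in> carrier G; a \<in> S; R < word_length G S p\<rbrakk>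
                 \<Longrightarrow> \<Delta> p (p \<otimes> a) \<le> C * r ^ word_length G S p"
    and C: "0 \<le> C" and r: "0 < r" "r < 1"
begin

lemma \<Delta>_nonneg: "\<lbrakk>p \<in> carrier G; q \<in> carrier G\<rbrakk> \<Longrightarrow> 0 \<le> \<Delta> p q"
  using \<Delta>_triangle[of p q p] \<Delta>_commute[of p q] \<Delta>_refl[of p] by simp

text \<open>Each letter lowers the word length by at most one, so the whole path stays outside the
  ball of radius \<open>R\<close> and every step costs at most
  \<open>C * r ^ (word_length G S p - length ws)\<close>. The triangle inequality adds the steps
  up.\<close>

lemma slow_along_word:
  assumes "set ws \<subseteq> S" "p \<in> carrier G" "R + length ws < word_length G S p"
  shows "\<Delta> p (p \<otimes> word_value G ws) \<le> length ws * C * r ^ (word_length G S p - length ws)"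
  using assms
proof (induction ws arbitrary: p)
  case Nil
  then show ?case by (simp add: \<Delta>_refl)
next
  case (Cons a ws)
  have a: "a \<in> S" "a \<in> carrier G" "set ws \<subseteq> S" "set ws \<subseteq> carrier G"
    using Cons.prems S_carrier[of "a # ws"] by auto
  have "word_length G S a \<le> 1"
    using word_length_le[of "[a]"] a by simp
  then have len: "word_length G S p \<le> Suc (word_length G S (p \<otimes> a))"
    using word_length_mult_le[of "p \<otimes> a" "inv a"] a Cons.prems
    by (simp add: m_assoc word_length_inv)
  have "\<Delta> p (p \<otimes> word_value G (a # ws))
          \<le> \<Delta> p (p \<otimes> a) + \<Delta> (p \<otimes> a) (p \<otimes> a \<otimes> word_value G ws)"
    using a Cons.prems \<Delta>_triangle[of p "p \<otimes> a" "p \<otimes> a \<otimes> word_value G ws"] by (simp add: m_assoc)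
  also have "\<Delta> p (p \<otimes> a) \<le> C * r ^ word_length G S p"
    using slow a Cons.prems by simp
  also have "\<dots> \<le> C * r ^ (word_length G S p - length (a # ws))"
    using C r by (intro mult_left_mono power_decreasing) auto
  also have "\<Delta> (p \<otimes> a) (p \<otimes> a \<otimes> word_value G ws)
      \<le> length ws * C * r ^ (word_length G S (p \<otimes> a) - length ws)"
    using a Cons.prems len by (intro Cons.IH) auto
  also have "\<dots> \<le> length ws * C * r ^ (word_length G S p - length (a # ws))"
    using C r len by (intro mult_left_mono power_decreasing) auto
  finally show ?case by (simp add: algebra_simps)
qed

end

section \<open>Cones based at the identity: geodesics, connectedness, complements of points\<close>

locale word_cone = word_data G S for G :: "('g, 'm) monoid_scheme" (structure) and S +
  fixes \<omega> :: "nat filter" and s :: "nat \<Rightarrow> real"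
  assumes ultra: "nonprincipal_ultrafilter \<omega>"
    and scale: "\<And>n. 0 < s n"
    and scale_at_top: "filterlim s at_top \<omega>"
begin

abbreviation "wd \<equiv> word_dist G S"
abbreviation "seqs \<equiv> cone_seqs (carrier G) wd \<omega> (\<lambda>_. \<one>) s"
abbreviation "crel \<equiv> cone_rel (carrier G) wd \<omega> (\<lambda>_. \<one>) s"
abbreviation "points \<equiv> cone_points (carrier G) wd \<omega> (\<lambda>_. \<one>) s"
abbreviation "cdist \<equiv> cone_dist (carrier G) wd \<omega> (\<lambda>_. \<one>) s"
abbreviation "Cone \<equiv> asymptotic_cone (carrier G) wd \<omega> (\<lambda>_. \<one>) s"

sublocale wm: Metric_space "carrier G" wd
  by (rule Metric_space_word_dist)

sublocale cone: cone_data "carrier G" wd \<omega> "\<lambda>_. \<one>" s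
  by unfold_locales (use ultra scale in auto)

sublocale cm: Metric_space points cdist
  by (rule cone.Metric_space_cone)

lemma cone_eq: "Cone = cm.mtopology"
  by (simp add: asymptotic_cone_def)

lemma topspace_cone [simp]: "topspace Cone = points"
  by (simp add: cone_eq)

lemma seqs_closed: "x \<in> seqs \<Longrightarrow> x n \<in> carrier G"
  by (simp add: cone_seqs_def)

lemma seqs_near:
  assumes x: "x \<in> seqs" and y: "\<And>n. y n \<in> carrier G"
    and B: "eventually (\<lambda>n. wd (x n) (y n) / s n \<le> B) \<omega>"
  shows "y \<in> seqs"
proof -
  obtain B' where "eventually (\<lambda>n. wd \<one> (x n) / s n \<le> B') \<omega>"
    using x by (auto simp: cone_seqs_def)
  with B have "eventually (\<lambda>n. wd \<one> (y n) / s n \<le> B' + B) \<omega>"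
  proof eventually_elim
    case (elim n)
    have "wd \<one> (y n) / s n \<le> (wd \<one> (x n) + wd (x n) (y n)) / s n"
      using wm.triangle[of \<one> "x n" "y n"] y scale[of n] seqs_closed[OF x]
      by (intro divide_right_mono) auto
    with elim show ?case by (simp add: add_divide_distrib)
  qed
  with y show ?thesis by (auto simp: cone_seqs_def)
qed

definition pt :: "(nat \<Rightarrow> 'g) \<Rightarrow> (nat \<Rightarrow> 'g) set" where
  "pt x = crel `` {x}"

lemma pt_in: "x \<in> seqs \<Longrightarrow> pt x \<in> points"
  by (simp add: pt_def cone_points_def quotientI)

lemma in_pt: "x \<in> seqs \<Longrightarrow> x \<in> pt x"
  unfolding pt_def by (rule equiv_class_self[OF cone.equiv_cone_rel])

lemma points_cases:
  assumes "X \<in> points" obtains x where "x \<in> seqs" "X = pt x"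
  using assms by (auto simp: cone_points_def pt_def elim: quotientE)

lemma cdist_pt: "\<lbrakk>x \<in> seqs; y \<in> seqs\<rbrakk> \<Longrightarrow> cdist (pt x) (pt y) = ulim_dist wd \<omega> s x y"
  by (intro cone.cone_dist_eq pt_in in_pt)

lemma cdist_tendsto:
  "\<lbrakk>x \<in> seqs; y \<in> seqs\<rbrakk> \<Longrightarrow> ((\<lambda>n. wd (x n) (y n) / s n) \<longlongrightarrow> cdist (pt x) (pt y)) \<omega>"
  using cone.ulim_dist_tendsto by (simp add: cdist_pt)

text \<open>Geodesic words from \<open>x n\<close> to \<open>y n\<close>, cut off at a common
  fraction \<open>t\<close> of their length, give in the limit a Lipschitz path; \<open>K\<close> is
  its image. The bound on the distance from \<open>X\<close> is what makes balls connected.\<close>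

lemma cone_path:
  assumes X: "X \<in> points" and Y: "Y \<in> points"
  shows "\<exists>K. connectedin Cone K \<and> X \<in> K \<and> Y \<in> K \<and> (\<forall>Z\<in>K. cdist X Z \<le> cdist X Y)"
proof -
  obtain x y where x: "x \<in> seqs" "X = pt x" and y: "y \<in> seqs" "Y = pt y"
    using X Y by (metis points_cases)
  have xy: "x n \<in> carrier G" "y n \<in> carrier G" for n
    using x y seqs_closed by auto
  have "\<exists>ws. length ws = wd (x n) (y n) \<and> set ws \<subseteq> S \<and> word_value G ws = inv (x n) \<otimes> y n" for n
    using word_length_witness[of "inv (x n) \<otimes> y n"] xy by (simp add: word_dist_def) metis
  then obtain ws where len: "\<And>n. length (ws n) = wd (x n) (y n)"
    and S: "\<And>n. set (ws n) \<subseteq> S" and val: "\<And>n. word_value G (ws n) = inv (x n) \<otimes> y n"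
    by metis
  have ws_carrier: "set (ws n) \<subseteq> carrier G" for n
    using S S_carrier by auto
  define m where "m t n = nat \<lfloor>t * real (length (ws n))\<rfloor>" for t :: real and n
  define \<gamma> where "\<gamma> t n = x n \<otimes> word_value G (take (m t n) (ws n))" for t n
  have take_carrier: "set (take k (ws n)) \<subseteq> carrier G" "set (drop k (take k' (ws n))) \<subseteq> carrier G"
    "set (drop k (take k' (ws n))) \<subseteq> S" for k k' n
    using ws_carrier S by (meson set_drop_subset set_take_subset subset_trans)+
  have closed: "\<gamma> t n \<in> carrier G" for t n
    using xy take_carrier by (simp add: \<gamma>_def)
  \<comment> \<open>The additional 1 pays for the rounding in \<open>m\<close>; division by
    \<open>s n\<close> makes it vanish in the cone.\<close>
  have dist: "wd (\<gamma> t n) (\<gamma> t' n) \<le> (t' - t) * wd (x n) (y n) + 1" if "0 \<le> t" "t \<le> t'" "t' \<le> 1" for t t' :: real and n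
  proof -
    have mm: "m t n \<le> m t' n"
      using that by (auto simp: m_def intro!: nat_mono floor_mono mult_right_mono)
    then have tk: "take (m t' n) (ws n) = take (m t n) (ws n) @ drop (m t n) (take (m t' n) (ws n))"
      by (metis append_take_drop_id min.absorb1 take_take)
    have "\<gamma> t' n = \<gamma> t n \<otimes> word_value G (drop (m t n) (take (m t' n) (ws n)))"
      unfolding \<gamma>_def by (subst tk) (use xy take_carrier in \<open>simp add: word_value_append m_assoc\<close>)
    then have "wd (\<gamma> t n) (\<gamma> t' n) = word_length G S (word_value G (drop (m t n) (take (m t' n) (ws n))))"
      using word_dist_mult closed take_carrier by simp
    also have "\<dots> \<le> length (drop (m t n) (take (m t' n) (ws n)))"
      using word_length_le take_carrier(3) by (simp only: of_nat_le_iff)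
    also have "\<dots> \<le> real (m t' n) - m t n"
      using mm by (simp add: of_nat_diff)
    also have "\<dots> \<le> (t' - t) * wd (x n) (y n) + 1"
    proof -
      have "0 \<le> t * length (ws n)" "0 \<le> t' * length (ws n)"
        using that by auto
      then show ?thesis
        using len[of n] unfolding m_def by (auto simp: left_diff_distrib) linarith
    qed
    finally show ?thesis .
  qed
  have seqs: "\<gamma> t \<in> seqs" if "0 \<le> t" "t \<le> 1" for t
  proof (rule seqs_near[OF x(1)])
    show "eventually (\<lambda>n. wd (x n) (\<gamma> t n) / s n \<le> cdist X Y + 1) \<omega>"
      using order_tendstoD(2)[OF cdist_tendsto[OF x(1) y(1)] less_add_one]
    proof eventually_elim
      case n: (elim n)
      have "wd (x n) (\<gamma> t n) = word_length G S (word_value G (take (m t n) (ws n)))"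
        unfolding \<gamma>_def using xy take_carrier by (intro word_dist_mult) auto
      also have "\<dots> \<le> length (take (m t n) (ws n))"
        using S[of n] set_take_subset[of "m t n" "ws n"]
        by (simp only: of_nat_le_iff) (intro word_length_le, blast)
      also have "\<dots> \<le> wd (x n) (y n)"
        by (simp flip: len)
      finally have "wd (x n) (\<gamma> t n) / s n \<le> wd (x n) (y n) / s n"
        using scale[of n] by (simp add: divide_right_mono)
      with n show ?case
        by (simp add: x y)
    qed
  qed (rule closed)
  have le: "cdist (pt (\<gamma> t)) (pt (\<gamma> t')) \<le> (t' - t) * cdist X Y" if t: "0 \<le> t" "t \<le> t'" "t' \<le> 1" for t t'
  proof (rule tendsto_le[OF cone.nontriv _ cdist_tendsto])
    have "((\<lambda>n. 1 / s n) \<longlongrightarrow> 0) \<omega>"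
      using scale_at_top by (intro tendsto_divide_0[OF tendsto_const])
        (auto intro: filterlim_at_top_imp_at_infinity)
    from tendsto_add[OF tendsto_mult_left[OF cdist_tendsto[OF x(1) y(1)], of "t' - t"] this]
    show "((\<lambda>n. (t' - t) * (wd (x n) (y n) / s n) + 1 / s n) \<longlongrightarrow> (t' - t) * cdist X Y) \<omega>"
      by (simp add: x y)
    show "eventually (\<lambda>n. wd (\<gamma> t n) (\<gamma> t' n) / s n \<le> (t' - t) * (wd (x n) (y n) / s n) + 1 / s n) \<omega>"
    proof (intro always_eventually allI)
      fix n
      show "wd (\<gamma> t n) (\<gamma> t' n) / s n \<le> (t' - t) * (wd (x n) (y n) / s n) + 1 / s n"
        using divide_right_mono[OF dist[OF t], of "s n" n] scale[of n] by (simp add: add_divide_distrib)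
    qed
    show "\<gamma> t \<in> seqs" "\<gamma> t' \<in> seqs" using t seqs by auto
  qed
  have abs_le: "cdist (pt (\<gamma> t)) (pt (\<gamma> t')) \<le> \<bar>t' - t\<bar> * cdist X Y"
    if "0 \<le> t" "t \<le> 1" "0 \<le> t'" "t' \<le> 1" for t t'
    using le[of t t'] le[of t' t] that cm.commute[of "pt (\<gamma> t)" "pt (\<gamma> t')"] by (cases "t \<le> t'") auto
  have "\<gamma> 0 = x"
    using xy by (auto simp: \<gamma>_def m_def)
  then have 0: "pt (\<gamma> 0) = X" using x by simp
  have "\<gamma> 1 = y"
    using xy by (auto simp: \<gamma>_def m_def val simp flip: m_assoc)
  then have 1: "pt (\<gamma> 1) = Y" using y by simp
  have "continuous_map (top_of_set {0..1}) Cone (\<lambda>t. pt (\<gamma> t))"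
    unfolding cone_eq cm.continuous_map_to_metric
  proof (intro ballI allI impI)
    fix t \<epsilon> :: real assume t: "t \<in> topspace (top_of_set {0..1})" and \<epsilon>: "0 < \<epsilon>"
    \<comment> \<open>The summand 1 keeps \<open>D\<close> positive when \<open>X\<close> and
      \<open>Y\<close> coincide, so that \<open>\<epsilon> / D\<close> is a legitimate
      radius.\<close>
    define D where "D = cdist X Y + 1"
    have D: "0 < D" "cdist X Y \<le> D" using cm.nonneg[of X Y] unfolding D_def by linarith+
    have "pt (\<gamma> t') \<in> cm.mball (pt (\<gamma> t)) \<epsilon>" if t': "t' \<in> {0..1} \<inter> ball t (\<epsilon> / D)" for t'
    proof -
      have "cdist (pt (\<gamma> t)) (pt (\<gamma> t')) \<le> \<bar>t' - t\<bar> * D"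
        using t t' D by (intro order_trans[OF abs_le mult_left_mono]) auto
      also have "\<dots> < \<epsilon>"
        using t' D by (auto simp: dist_real_def pos_less_divide_eq abs_minus_commute)
      finally show ?thesis using t t' seqs pt_in by auto
    qed
    then show "\<exists>U. openin (top_of_set {0..1}) U \<and> t \<in> U \<and> (\<forall>y\<in>U. pt (\<gamma> y) \<in> cm.mball (pt (\<gamma> t)) \<epsilon>)"
      using t D \<epsilon> by (intro exI[of _ "{0..1} \<inter> ball t (\<epsilon> / D)"]) auto
  qed
  from connectedin_continuous_map_image[OF this, of "{0..1}"]
  have "connectedin Cone ((\<lambda>t. pt (\<gamma> t)) ` {0..1})"
    by (simp add: connectedin_subtopology)
  moreover have "cdist X (pt (\<gamma> t)) \<le> cdist X Y" if "t \<in> {0..1}" for t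
    using le[of 0 t] that 0 mult_right_mono[of t 1 "cdist X Y"] by simp
  ultimately show ?thesis
    using 0 1 by (intro exI[of _ "(\<lambda>t. pt (\<gamma> t)) ` {0..1}"]) force
qed

text \<open>The sets from \<open>cone_path\<close> that join the centre to a point of the ball do
  not leave the ball, so the ball is a union of connected sets with a common point.\<close>

lemma connectedin_mball: "connectedin Cone (cm.mball X r)"
proof (cases "X \<in> points \<and> 0 < r")
  case True
  define \<K> where "\<K> = {K. connectedin Cone K \<and> X \<in> K \<and> K \<subseteq> cm.mball X r}"
  have "X \<in> \<Inter>\<K>" by (auto simp: \<K>_def)
  then have conn: "connectedin Cone (\<Union>\<K>)"
    by (intro connectedin_Union) (auto simp: \<K>_def)
  have "Y \<in> \<Union>\<K>" if Y: "Y \<in> cm.mball X r" for Y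
  proof -
    have "X \<in> points" "Y \<in> points" "cdist X Y < r" using Y by auto
    then obtain K where K: "connectedin Cone K" "X \<in> K" "Y \<in> K"
      and le: "\<And>Z. Z \<in> K \<Longrightarrow> cdist X Z \<le> cdist X Y"
      using cone_path[of X Y] by blast
    have "K \<subseteq> cm.mball X r"
    proof
      fix Z assume "Z \<in> K"
      then have "Z \<in> points" "cdist X Z \<le> cdist X Y"
        using connectedin_subset_topspace[OF K(1)] le by auto
      then show "Z \<in> cm.mball X r"
        using \<open>X \<in> points\<close> \<open>cdist X Y < r\<close> by simp
    qed
    then have "K \<in> \<K>" using K by (simp add: \<K>_def)
    then show ?thesis using K(3) by (rule UnionI)
  qed
  then have "cm.mball X r \<subseteq> \<Union>\<K>" by (rule subsetI)
  moreover have "\<Union>\<K> \<subseteq> cm.mball X r" unfolding \<K>_def by (rule Union_least) simp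
  ultimately have "\<Union>\<K> = cm.mball X r" by (rule equalityI[rotated])
  with conn show ?thesis by (rule back_subst)
next
  case False
  then have "cm.mball X r = {}"
    by (auto simp only: cm.mball_eq_empty not_less de_Morgan_conj)
  then show ?thesis by simp
qed

lemma connected_cone: "connected_space Cone"
proof -
  have "\<exists>K. connectedin Cone K \<and> X \<in> K \<and> Y \<in> K" if "X \<in> points" "Y \<in> points" for X Y
    using cone_path[OF that] by blast
  then show ?thesis
    unfolding connected_space_subconnected by simp
qed

lemma locally_connected_cone: "locally_connected_space Cone"
  unfolding locally_connected_space
proof (intro allI impI)
  fix V X assume "openin Cone V \<and> X \<in> V"
  then obtain r where "r > 0" "cm.mball X r \<subseteq> V" "X \<in> points"
    unfolding cone_eq cm.openin_mtopology by blast
  then show "\<exists>U. openin Cone U \<and> connectedin Cone U \<and> X \<in> U \<and> U \<subseteq> V"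
    using connectedin_mball by (intro exI[of _ "cm.mball X r"]) (auto simp: cone_eq)
qed

text \<open>Since the cone is connected and locally connected, as \<open>cut_point\<close> demands,
  two distinct components of the complement would make \<open>P\<close> a cut point. So
  \<open>X\<close> and \<open>Y\<close> share a component.\<close>

lemma connected_minus_non_cut_point:
  assumes no_cut: "\<not> cut_point Cone P" and "P \<in> points"
    and X: "X \<in> points - {P}" and Y: "Y \<in> points - {P}"
  shows "\<exists>K. connectedin Cone K \<and> K \<subseteq> points - {P} \<and> X \<in> K \<and> Y \<in> K"
proof -
  let ?T = "subtopology Cone (points - {P})"
  have "connected_component_of_set ?T X = connected_component_of_set ?T Y"
  proof (rule ccontr)
    assume "connected_component_of_set ?T X \<noteq> connected_component_of_set ?T Y"
    moreover have "connected_component_of_set ?T Z \<in> connected_components_of ?T" if "Z \<in> points - {P}" for Z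
      using that by (simp add: connected_component_in_connected_components_of)
    ultimately have "cut_point Cone P"
      using X Y \<open>P \<in> points\<close> connected_cone locally_connected_cone
      unfolding cut_point_def by (simp only: topspace_cone) blast
    then show False using no_cut by blast
  qed
  moreover have "connected_component_of ?T Y Y"
    using Y by (simp add: connected_component_of_refl)
  ultimately have "connected_component_of ?T X Y"
    by (metis mem_Collect_eq)
  then show ?thesis
    by (auto simp: connected_component_of_def connectedin_subtopology)
qed

end

section \<open>Limits of slowly varying pseudometrics along sequences in the cone\<close>

lemma linear_times_geometric_tendsto_0:
  fixes r k :: real
  assumes "0 < r" "r < 1" "0 < k"
  shows "((\<lambda>t. t * r powr (k * t)) \<longlongrightarrow> 0) at_top"
proof -
  define a where "a = - (k * ln r)"
  have "0 < a" using assms by (simp add: a_def mult_pos_neg)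
  then have "((\<lambda>t. t * exp (- (a * t))) \<longlongrightarrow> 0) at_top"
    by real_asymp
  moreover have "r powr (k * t) = exp (- (a * t))" for t
    using assms by (simp add: powr_def a_def mult_ac)
  ultimately show ?thesis by simp
qed

locale slow_cone = word_cone G S \<omega> s + slow_distance G S \<Delta> C r R
  for G :: "('g, 'm) monoid_scheme" (structure) and S \<omega> s \<Delta> C r R
begin

abbreviation "origin \<equiv> pt (\<lambda>_. \<one>)"

lemma one_in_seqs: "(\<lambda>_. \<one>) \<in> seqs"
  by (auto simp: cone_seqs_def intro: exI[of _ 0])

text \<open>With \<open>\<rho>\<close> the distance of \<open>pt y\<close> from the origin,
  \<open>y n\<close> eventually has length above \<open>3/4 * \<rho> * s n\<close>, while a geodesic
  word to \<open>y' n\<close> has fewer than \<open>\<rho> / 4 * s n\<close> letters. The path thus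
  stays at length above \<open>\<rho> / 2 * s n\<close>, and its cost is a linear factor times an
  exponentially small one.\<close>

lemma slow_near:
  assumes y: "y \<in> seqs" and y': "y' \<in> seqs"
    and far: "0 < cdist origin (pt y)" and near: "cdist (pt y) (pt y') < cdist origin (pt y) / 4"
  shows "((\<lambda>n. \<Delta> (y n) (y' n)) \<longlongrightarrow> 0) \<omega>"
proof -
  define \<rho> where "\<rho> = cdist origin (pt y)"
  have \<rho>: "0 < \<rho>" using far by (simp add: \<rho>_def)
  have closed: "y n \<in> carrier G" "y' n \<in> carrier G" for n
    using y y' seqs_closed by auto
  have "eventually (\<lambda>n. 3/4 * \<rho> < wd \<one> (y n) / s n) \<omega>"
    by (rule order_tendstoD(1)[OF cdist_tendsto[OF one_in_seqs y]]) (use \<rho> in \<open>simp add: \<rho>_def\<close>)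
  moreover have "eventually (\<lambda>n. wd (y n) (y' n) / s n < \<rho> / 4) \<omega>"
    by (rule order_tendstoD(2)[OF cdist_tendsto[OF y y']]) (use near in \<open>simp add: \<rho>_def\<close>)
  moreover have "eventually (\<lambda>n. R / (\<rho> / 2) \<le> s n) \<omega>"
    using scale_at_top by (simp add: filterlim_at_top)
  ultimately have "eventually (\<lambda>n. \<Delta> (y n) (y' n) \<le> \<rho> / 4 * C * (s n * r powr (\<rho> / 2 * s n))) \<omega>"
  proof eventually_elim
    case (elim n)
    obtain ws where ws: "length ws = word_length G S (inv (y n) \<otimes> y' n)" "set ws \<subseteq> S"
      "word_value G ws = inv (y n) \<otimes> y' n"
      using word_length_witness[of "inv (y n) \<otimes> y' n"] closed by auto
    have len: "real (length ws) = wd (y n) (y' n)"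
      using closed ws(1) by (simp add: word_dist_def)
    have y_ws: "y n \<otimes> word_value G ws = y' n"
      using closed ws(3) by (simp flip: m_assoc)
    have 1: "3/4 * \<rho> * s n < word_length G S (y n)" and 2: "length ws < \<rho> / 4 * s n"
      and 3: "R \<le> \<rho> / 2 * s n"
      using elim scale[of n] \<rho> closed by (simp_all add: len word_dist_one field_simps)
    have 4: "\<rho> / 2 * s n < real (word_length G S (y n)) - length ws"
      using 1 2 by linarith
    have 5: "R + length ws < word_length G S (y n)"
      using 3 4 by linarith
    have "r ^ (word_length G S (y n) - length ws) = r powr (real (word_length G S (y n)) - length ws)"
      using 5 r by (simp add: of_nat_diff flip: powr_realpow)
    also have "\<dots> \<le> r powr (\<rho> / 2 * s n)"
      using 4 r by (intro powr_mono') auto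
    finally have 6: "r ^ (word_length G S (y n) - length ws) \<le> r powr (\<rho> / 2 * s n)" .
    have "\<Delta> (y n) (y' n) \<le> length ws * C * r ^ (word_length G S (y n) - length ws)"
      using slow_along_word[OF ws(2) closed(1) 5] by (simp add: y_ws)
    also have "\<dots> \<le> (\<rho> / 4 * s n * C) * r powr (\<rho> / 2 * s n)"
      using 2 6 C r scale[of n] \<rho> by (intro mult_mono mult_right_mono) auto
    finally show ?case
      by (simp add: mult_ac)
  qed
  moreover have "((\<lambda>n. \<rho> / 4 * C * (s n * r powr (\<rho> / 2 * s n))) \<longlongrightarrow> 0) \<omega>"
    using \<rho> r by (intro tendsto_mult_right_zero
        filterlim_compose[OF linear_times_geometric_tendsto_0 scale_at_top]) auto
  ultimately show ?thesis
    by (rule real_tendsto_sandwich[OF always_eventually _ tendsto_const[of 0], rotated])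
      (simp add: \<Delta>_nonneg closed)
qed

text \<open>By \<open>slow_near\<close>, having representatives whose \<open>\<Delta>\<close>-distance tends to 0 is an equivalence relation
  with open classes on the complement of the base point.\<close>

lemma slow_limit:
  assumes no_cut: "\<not> cut_point Cone origin"
    and x: "x \<in> seqs" "0 < cdist origin (pt x)" and y: "y \<in> seqs" "0 < cdist origin (pt y)"
  shows "((\<lambda>n. \<Delta> (x n) (y n)) \<longlongrightarrow> 0) \<omega>"
proof -
  let ?P = "points - {origin}"
  let ?lim = "\<lambda>u v. ((\<lambda>n. \<Delta> (u n) (v n)) \<longlongrightarrow> 0) \<omega>"
  have trans: "?lim u w" if "?lim u v" "?lim v w" "u \<in> seqs" "v \<in> seqs" "w \<in> seqs" for u v w
  proof (rule real_tendsto_sandwich[OF always_eventually always_eventually tendsto_const[of 0]])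
    show "((\<lambda>n. \<Delta> (u n) (v n) + \<Delta> (v n) (w n)) \<longlongrightarrow> 0) \<omega>"
      using tendsto_add[OF that(1,2)] by simp
  qed (use that in \<open>auto intro: \<Delta>_nonneg \<Delta>_triangle seqs_closed\<close>)
  have P: "X \<in> ?P \<longleftrightarrow> X \<in> points \<and> 0 < cdist origin X" for X
    using pt_in[OF one_in_seqs] cm.mdist_pos_eq by auto
  \<comment> \<open>Membership in \<open>U\<close> or \<open>V\<close> asks only for some
    representative with the property; \<open>disj\<close> below is the proof that the property
    depends on the point alone.\<close>
  define U where "U = {pt u |u. u \<in> seqs \<and> 0 < cdist origin (pt u) \<and> ?lim x u}"
  define V where "V = {pt u |u. u \<in> seqs \<and> 0 < cdist origin (pt u) \<and> \<not> ?lim x u}"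
  have close: "v \<in> seqs \<and> 0 < cdist origin (pt v) \<and> ?lim u v \<and> ?lim v u"
    if u: "u \<in> seqs" "0 < cdist origin (pt u)" and v: "v \<in> seqs" "cdist (pt u) (pt v) < cdist origin (pt u) / 4"
    for u v
  proof -
    have "cdist origin (pt u) \<le> cdist origin (pt v) + cdist (pt v) (pt u)"
      using cm.triangle pt_in one_in_seqs u v by blast
    then have "0 < cdist origin (pt v)"
      using u v cm.commute[of "pt v" "pt u"] by linarith
    moreover have "?lim u v" using slow_near u v by blast
    moreover from this have "?lim v u"
      using \<Delta>_commute seqs_closed u(1) v(1) by simp
    ultimately show ?thesis using v(1) by blast
  qed
  have "openin Cone U"
    unfolding cone_eq cm.openin_mtopology
  proof (intro conjI allI impI)
    show "U \<subseteq> points" using pt_in by (auto simp: U_def)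
    fix X assume "X \<in> U"
    then obtain u where u: "X = pt u" "u \<in> seqs" "0 < cdist origin (pt u)" "?lim x u"
      by (auto simp: U_def)
    have "Y \<in> U" if "Y \<in> cm.mball X (cdist origin X / 4)" for Y
    proof -
      have "Y \<in> points" and Y: "cdist X Y < cdist origin X / 4" using that by auto
      then obtain v where v: "v \<in> seqs" "Y = pt v" by (metis points_cases)
      with close[of u v] u Y trans[of x u v] x show ?thesis
        unfolding U_def by blast
    qed
    then show "\<exists>r>0. cm.mball X r \<subseteq> U"
      using u by (intro exI[of _ "cdist origin X / 4"]) auto
  qed
  moreover have "openin Cone V"
    unfolding cone_eq cm.openin_mtopology
  proof (intro conjI allI impI)
    show "V \<subseteq> points" using pt_in by (auto simp: V_def)
    fix X assume "X \<in> V"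
    then obtain u where u: "X = pt u" "u \<in> seqs" "0 < cdist origin (pt u)" "\<not> ?lim x u"
      by (auto simp: V_def)
    have "Y \<in> V" if "Y \<in> cm.mball X (cdist origin X / 4)" for Y
    proof -
      have "Y \<in> points" and Y: "cdist X Y < cdist origin X / 4" using that by auto
      then obtain v where v: "v \<in> seqs" "Y = pt v" by (metis points_cases)
      with close[of u v] u Y trans[of x v u] x show ?thesis
        unfolding V_def by blast
    qed
    then show "\<exists>r>0. cm.mball X r \<subseteq> V"
      using u by (intro exI[of _ "cdist origin X / 4"]) auto
  qed
  moreover have disj: "U \<inter> V = {}"
  proof -
    have False if u: "u \<in> seqs" "0 < cdist origin (pt u)" "?lim x u"
      and v: "v \<in> seqs" "pt v = pt u" "\<not> ?lim x v" for u v
    proof -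
      have "cdist (pt u) (pt v) = 0"
        using v pt_in[OF u(1)] by simp
      then have "?lim u v" using close[of u v] u v by simp
      then show False using trans[of x u v] u v x by blast
    qed
    then show ?thesis unfolding U_def V_def by blast
  qed
  moreover have P_sub: "?P \<subseteq> U \<union> V"
  proof
    fix X assume "X \<in> ?P"
    then have "X \<in> points" "0 < cdist origin X" using P by auto
    moreover from this obtain u where "u \<in> seqs" "X = pt u" by (metis points_cases)
    ultimately show "X \<in> U \<union> V" unfolding U_def V_def by blast
  qed
  moreover have in_P: "pt x \<in> ?P" "pt y \<in> ?P"
    using x y P pt_in by blast+
  moreover obtain K where K: "connectedin Cone K" "K \<subseteq> ?P" "pt x \<in> K" "pt y \<in> K"
    using connected_minus_non_cut_point[OF no_cut pt_in[OF one_in_seqs] in_P] by blast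
  ultimately have "U \<inter> K = {} \<or> V \<inter> K = {}"
    using connectedinD[OF K(1), of U V] by blast
  moreover have "pt x \<in> U"
    using x \<Delta>_refl seqs_closed unfolding U_def by (auto intro!: exI[of _ x])
  ultimately have "pt y \<in> U"
    using K P_sub by blast
  then obtain u where u: "u \<in> seqs" "pt u = pt y" "0 < cdist origin (pt u)" "?lim x u"
    unfolding U_def by auto
  then have "cdist (pt u) (pt y) = 0" using pt_in[OF y(1)] by simp
  then have "?lim u y" using close[of u y] u y by simp
  then show ?thesis using trans u x y by blast
qed

lemma pt_far:
  assumes x: "\<And>n. x n \<in> carrier G" and "0 < l"
    and bounds: "eventually (\<lambda>n. l * s n \<le> word_length G S (x n) \<and> word_length G S (x n) \<le> K * s n) \<omega>"
  shows "x \<in> seqs" "0 < cdist origin (pt x)"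
proof -
  have *: "eventually (\<lambda>n. l \<le> wd \<one> (x n) / s n \<and> wd \<one> (x n) / s n \<le> K) \<omega>"
    using bounds by eventually_elim (use x scale in \<open>simp add: word_dist_one field_simps\<close>)
  then have "eventually (\<lambda>n. wd \<one> (x n) / s n \<le> K) \<omega>"
    by (rule eventually_mono) simp
  with x show in_seqs: "x \<in> seqs"
    by (auto simp: cone_seqs_def)
  have "l \<le> cdist origin (pt x)"
    by (rule tendsto_lowerbound[OF cdist_tendsto[OF one_in_seqs in_seqs] _ cone.nontriv])
      (use * in \<open>auto elim: eventually_mono\<close>)
  with \<open>0 < l\<close> show "0 < cdist origin (pt x)" by simp
qed

end

section \<open>Groups with a bi-invariant metric\<close>

text \<open>A geometric series bounds the tails. The threshold \<open>N\<close> is for powers of the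
  undistorted element, whose increments are controlled only once the powers are long enough; for
  truncations it will be 0.\<close>

lemma (in Metric_space) mcomplete_geometric_limit:
  assumes "mcomplete" and u: "\<And>k. u k \<in> M"
    and q: "0 \<le> q" "q < 1" "0 \<le> K"
    and step: "\<And>k::nat. N \<le> k \<Longrightarrow> d (u k) (u (Suc k)) \<le> K * q ^ k"
  shows "\<exists>l\<in>M. (\<lambda>k. d (u k) l) \<longlonglongrightarrow> 0"
proof -
  have tail: "d (u k) (u (k + j)) \<le> K * q ^ k / (1 - q)" if "N \<le> k" for k j
  proof -
    have "d (u k) (u (k + j)) \<le> K * q ^ k * (\<Sum>i<j. q ^ i)"
    proof (induction j)
      case (Suc j)
      have "d (u k) (u (k + Suc j)) \<le> d (u k) (u (k + j)) + d (u (k + j)) (u (Suc (k + j)))"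
        using triangle u by simp
      also have "\<dots> \<le> K * q ^ k * (\<Sum>i<j. q ^ i) + K * q ^ (k + j)"
        using Suc step[of "k + j"] that by simp
      finally show ?case by (simp add: power_add algebra_simps)
    qed (use u in simp)
    also have "(\<Sum>i<j. q ^ i) \<le> 1 / (1 - q)"
      using q sum_le_suminf[of "\<lambda>i. q ^ i" "{..<j}"] by (simp add: suminf_geometric summable_geometric)
    finally show ?thesis
      using q by (simp add: mult_left_mono)
  qed
  have "MCauchy u"
    unfolding MCauchy_def
  proof (intro conjI allI impI)
    show "range u \<subseteq> M" using u by auto
    fix \<epsilon> :: real assume "0 < \<epsilon>"
    have "(\<lambda>k. K * q ^ k / (1 - q)) \<longlonglongrightarrow> K * 0 / (1 - q)"
      using q by (intro tendsto_intros LIMSEQ_realpow_zero) auto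
    then have "eventually (\<lambda>k. K * q ^ k / (1 - q) < \<epsilon>) sequentially"
      using \<open>0 < \<epsilon>\<close> by (intro order_tendstoD) auto
    then have "eventually (\<lambda>k. N \<le> k \<and> K * q ^ k / (1 - q) < \<epsilon>) sequentially"
      using eventually_ge_at_top eventually_conj by blast
    then obtain N' where N': "\<And>k. N' \<le> k \<Longrightarrow> N \<le> k \<and> K * q ^ k / (1 - q) < \<epsilon>"
      by (auto simp: eventually_sequentially)
    have *: "d (u n) (u n') < \<epsilon>" if "N' \<le> n" "n \<le> n'" for n n'
      using tail[of n "n' - n"] N'[of n] that by fastforce
    show "\<exists>N. \<forall>n n'. N \<le> n \<longrightarrow> N \<le> n' \<longrightarrow> d (u n) (u n') < \<epsilon>"
    proof (intro exI allI impI)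
      fix n n' assume "N' \<le> n" "N' \<le> n'"
      then show "d (u n) (u n') < \<epsilon>"
        using *[of n n'] *[of n' n] commute[of "u n" "u n'"] by (cases "n \<le> n'") auto
    qed
  qed
  with \<open>mcomplete\<close> show ?thesis
    unfolding mcomplete_def limitin_metric_dist_null by blast
qed

locale biinvariant_group = group H + Metric_space "carrier H" d
  for H :: "('h, 'k) monoid_scheme" (structure) and d +
  assumes left_invariant: "\<lbrakk>a \<in> carrier H; x \<in> carrier H; y \<in> carrier H\<rbrakk> \<Longrightarrow> d (a \<otimes> x) (a \<otimes> y) = d x y"
    and right_invariant: "\<lbrakk>a \<in> carrier H; x \<in> carrier H; y \<in> carrier H\<rbrakk> \<Longrightarrow> d (x \<otimes> a) (y \<otimes> a) = d x y"
begin

text \<open>Translating by \<open>x\<close> on the left and by \<open>y\<close> on the right carries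
  the pair of inverses to the pair \<open>y\<close>, \<open>x\<close>.\<close>

lemma dist_inv:
  assumes "x \<in> carrier H" "y \<in> carrier H"
  shows "d (inv x) (inv y) = d x y"
proof -
  have "d (inv x) (inv y) = d (x \<otimes> inv x \<otimes> y) (x \<otimes> inv y \<otimes> y)"
    using assms left_invariant right_invariant by (metis inv_closed m_closed)
  also have "\<dots> = d y x"
    using assms by (simp add: m_assoc)
  finally show ?thesis by (simp add: commute)
qed

lemma dist_mult_le:
  assumes "a \<in> carrier H" "a' \<in> carrier H" "b \<in> carrier H" "b' \<in> carrier H"
  shows "d (a \<otimes> b) (a' \<otimes> b') \<le> d a a' + d b b'"
  using triangle[of "a \<otimes> b" "a' \<otimes> b" "a' \<otimes> b'"] assms
  by (simp add: left_invariant right_invariant)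

lemma limit_unique:
  assumes "F \<noteq> bot" "l \<in> carrier H" "l' \<in> carrier H" and "eventually (\<lambda>n. d l l' \<le> f n) F" and "(f \<longlongrightarrow> 0) F"
  shows "l = l'"
proof -
  have "d l l' \<le> 0"
    by (rule tendsto_lowerbound[OF assms(5,4,1)])
  with assms(2,3) show ?thesis
    using nonneg[of l l'] zero[of l l'] by linarith
qed

end

section \<open>Undistorted elements and wide groups\<close>

context word_data
begin

lemma word_length_mult_ge:
  assumes "g \<in> carrier G" "h \<in> carrier G"
  shows "word_length G S g \<le> word_length G S (g \<otimes> h) + word_length G S h"
    "word_length G S h \<le> word_length G S (g \<otimes> h) + word_length G S g"
proof -
  show "word_length G S g \<le> word_length G S (g \<otimes> h) + word_length G S h"
    using word_length_mult_le[of "g \<otimes> h" "inv h"] assms by (simp add: m_assoc word_length_inv)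
  show "word_length G S h \<le> word_length G S (g \<otimes> h) + word_length G S g"
    using word_length_mult_le[of "inv g" "g \<otimes> h"] assms by (simp add: word_length_inv flip: m_assoc)
qed

lemma word_length_one [simp]: "word_length G S \<one> = 0"
  by (simp add: word_length_eq_0_iff)

lemma word_length_pow_le:
  "g \<in> carrier G \<Longrightarrow> word_length G S (g [^] n) \<le> n * word_length G S g" for n :: nat
proof (induction n)
  case (Suc n)
  then show ?case using word_length_mult_le[of "g [^] n" g] by simp
qed simp

text \<open>Subadditivity bounds the average length along multiples of \<open>n\<close> by that of
  the \<open>n\<close>-th power itself. Passing to the limit along these multiples makes the limit
  \<open>L\<close> a lower bound at every \<open>n\<close>, not merely asymptotically.\<close>

lemma undistorted_lower_bound:
  assumes "undistorted G S g" and g: "g \<in> carrier G"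
  obtains l :: real where "0 < l" "\<And>n. l * real n \<le> word_length G S (g [^] n)"
proof -
  obtain L where "0 < L" and L: "(\<lambda>n::nat. word_length G S (g [^] n) / n) \<longlonglongrightarrow> L"
    using assms(1) by (auto simp: undistorted_def)
  have "L * n \<le> word_length G S (g [^] n)" for n :: nat
  proof (cases "n = 0")
    case False
    have "strict_mono (\<lambda>m. n * m)"
      using False by (simp add: strict_mono_def)
    from LIMSEQ_subseq_LIMSEQ[OF L this]
    have "(\<lambda>m. word_length G S (g [^] (n * m)) / (n * m)) \<longlonglongrightarrow> L"
      by (simp add: o_def)
    moreover have "word_length G S (g [^] (n * m)) / (n * m) \<le> word_length G S (g [^] n) / n"
      if "m \<ge> 1" for m
    proof -
      have "word_length G S (g [^] (n * m)) \<le> m * word_length G S (g [^] n)"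
        using word_length_pow_le[of "g [^] n" m] g by (simp add: nat_pow_pow)
      then have "real (word_length G S (g [^] (n * m))) \<le> m * word_length G S (g [^] n)"
        by (simp only: of_nat_mult[symmetric] of_nat_le_iff)
      then show ?thesis
        using False that by (simp add: field_simps)
    qed
    ultimately have "L \<le> word_length G S (g [^] n) / n"
      by (intro LIMSEQ_le_const2[of _ L]) blast+
    then show ?thesis using False by (simp add: field_simps)
  qed simp
  then show ?thesis using that[of L] \<open>0 < L\<close> by blast
qed

text \<open>After rescaling by a linear sequence, both \<open>p\<close> and \<open>q\<close> define
  points of the cone away from the base point. By wideness the base point is no cut point, so
  \<open>slow_limit\<close> applies.\<close>

lemma wide_slow_limit:
  fixes l k K :: real
  assumes "wide G S" and ultra: "nonprincipal_ultrafilter \<omega>" and slow: "slow_distance G S \<Delta> C r R"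
    and p: "\<And>n. p n \<in> carrier G" "\<And>n::nat. l * n - k \<le> word_length G S (p n)"
      "\<And>n::nat. word_length G S (p n) \<le> K * n + k"
    and q: "\<And>n. q n \<in> carrier G" "\<And>n::nat. l * n - k \<le> word_length G S (q n)"
      "\<And>n::nat. word_length G S (q n) \<le> K * n + k"
    and l: "0 < l" and "0 \<le> K" "0 \<le> k"
  shows "((\<lambda>n. \<Delta> (p n) (q n)) \<longlongrightarrow> 0) \<omega>"
proof -
  \<comment> \<open>The shift by 1 makes \<open>s 0\<close> positive, since \<open>wide\<close> asks
    for positive scaling constants at every index.\<close>
  define s where "s n = real n + 1" for n
  have \<omega>: "\<omega> \<le> sequentially"
    using ultra by (rule nonprincipal_ultrafilter_le_sequentially)
  have "filterlim s at_top sequentially"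
    unfolding s_def by real_asymp
  then have s: "filterlim s at_top \<omega>"
    using \<omega> filterlim_mono by blast
  interpret slow_distance G S \<Delta> C r R by fact
  interpret slow_cone G S \<omega> s \<Delta> C r R
    by unfold_locales (use ultra s in \<open>auto simp: s_def\<close>)
  have no_cut: "\<not> cut_point Cone origin"
    using assms(1) ultra s unfolding wide_def by (force simp: s_def)
  \<comment> \<open>Halving the slope absorbs \<open>k\<close> and the shift in \<open>s\<close> for
    all large \<open>n\<close>; the upper bound holds for every \<open>n\<close>.\<close>
  have bounds: "eventually (\<lambda>n. l/2 * s n \<le> w n \<and> w n \<le> (K + k) * s n) \<omega>"
    if w: "\<And>n. l * n - k \<le> w n" "\<And>n. w n \<le> K * n + k" for w :: "nat \<Rightarrow> real"
  proof -
    have "eventually (\<lambda>n. l/2 * (real n + 1) \<le> l * n - k) sequentially"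
      using l by real_asymp
    then have "eventually (\<lambda>n. l/2 * (real n + 1) \<le> l * n - k) \<omega>"
      using \<omega> filter_leD by blast
    then show ?thesis
    proof eventually_elim
      case (elim n)
      have "K * n + k \<le> (K + k) * s n"
        using \<open>0 \<le> K\<close> \<open>0 \<le> k\<close> by (simp add: s_def algebra_simps)
      with elim w[of n] show ?case unfolding s_def by linarith
    qed
  qed
  have "0 < l/2" using l by simp
  note far = pt_far[OF _ this bounds]
  show ?thesis
    using no_cut far[of p] far[of q] p q by (intro slow_limit) auto
qed

end

section \<open>Cocycles over full shifts\<close>

context word_data
begin

lemma shift_closed: "\<lbrakk>g \<in> carrier G; x \<in> full_shift G A\<rbrakk> \<Longrightarrow> shift G g x \<in> full_shift G A"
  by (auto simp: full_shift_def shift_def PiE_iff)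

lemma shift_apply: "h \<in> carrier G \<Longrightarrow> shift G g x h = x (inv g \<otimes> h)"
  by (simp add: shift_def)

text \<open>Real radii save later estimates from rounding. Rounding a radius down loses less than 1,
  which the constant absorbs through the factor \<open>1 / r\<close>.\<close>

lemma hoelder_continuous_powr:
  assumes "hoelder_continuous G S A d f"
  obtains C r where "0 < C" "0 < r" "r < 1"
    "\<And>(t::real) x y. \<lbrakk>0 \<le> t; x \<in> full_shift G A; y \<in> full_shift G A;
       \<And>h. \<lbrakk>h \<in> carrier G; word_length G S h \<le> t\<rbrakk> \<Longrightarrow> x h = y h\<rbrakk> \<Longrightarrow> d (f x) (f y) \<le> C * r powr t"
proof -
  obtain C r where C: "0 < C" "0 < r" "r < 1"
    and le: "\<And>n x y. \<lbrakk>x \<in> full_shift G A; y \<in> full_shift G A; \<forall>h\<in>word_ball G S n. x h = y h\<rbrakk>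
      \<Longrightarrow> d (f x) (f y) \<le> C * r ^ n"
    using assms unfolding hoelder_continuous_def by blast
  show ?thesis
  proof (rule that[of "C / r" r])
    fix t :: real and x y
    assume t: "0 \<le> t" and xy: "x \<in> full_shift G A" "y \<in> full_shift G A"
      and agree: "\<And>h. \<lbrakk>h \<in> carrier G; word_length G S h \<le> t\<rbrakk> \<Longrightarrow> x h = y h"
    have "d (f x) (f y) \<le> C * r ^ nat \<lfloor>t\<rfloor>"
      using t by (intro le xy) (auto simp: word_ball_def le_nat_iff le_floor_iff intro!: agree)
    also have "r ^ nat \<lfloor>t\<rfloor> = r powr of_int \<lfloor>t\<rfloor>"
      using t C by (simp flip: powr_realpow)
    also have "\<dots> \<le> r powr (t - 1)"
      using C by (intro powr_mono') linarith+
    also have "C * r powr (t - 1) = C / r * r powr t"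
      using C by (simp add: powr_diff)
    finally show "d (f x) (f y) \<le> C / r * r powr t"
      using C by simp
  qed (use C in auto)
qed

lemma uniform_hoelder_continuous:
  assumes "finite F" and "\<And>g. g \<in> F \<Longrightarrow> hoelder_continuous G S A d (c g)"
  obtains C r where "0 < C" "0 < r" "r < 1"
    "\<And>g (t::real) x y. \<lbrakk>g \<in> F; 0 \<le> t; x \<in> full_shift G A; y \<in> full_shift G A;
       \<And>h. \<lbrakk>h \<in> carrier G; word_length G S h \<le> t\<rbrakk> \<Longrightarrow> x h = y h\<rbrakk> \<Longrightarrow> d (c g x) (c g y) \<le> C * r powr t"
proof -
  let ?P = "\<lambda>F C r. 0 < C \<and> 0 < r \<and> r < 1 \<and>
    (\<forall>g\<in>F. \<forall>t::real. 0 \<le> t \<longrightarrow> (\<forall>x\<in>full_shift G A. \<forall>y\<in>full_shift G A.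
       (\<forall>h\<in>carrier G. word_length G S h \<le> t \<longrightarrow> x h = y h) \<longrightarrow> d (c g x) (c g y) \<le> C * r powr t))"
  have "\<exists>C r. ?P F C r"
    using assms
  proof (induction F)
    case empty
    show ?case by (intro exI[of _ 1] exI[of _ "1/2"]) auto
  next
    case (insert g F)
    then obtain C r where F: "?P F C r" by auto
    obtain C' r' where g: "0 < C'" "0 < r'" "r' < 1"
      "\<And>(t::real) x y. \<lbrakk>0 \<le> t; x \<in> full_shift G A; y \<in> full_shift G A;
         \<And>h. \<lbrakk>h \<in> carrier G; word_length G S h \<le> t\<rbrakk> \<Longrightarrow> x h = y h\<rbrakk> \<Longrightarrow> d (c g x) (c g y) \<le> C' * r' powr t"
      using hoelder_continuous_powr[of A d "c g"] insert.prems by blast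
    have le: "C * r powr t \<le> max C C' * max r r' powr t" "C' * r' powr t \<le> max C C' * max r r' powr t"
      if "0 \<le> t" for t :: real
      using that F g(1-3) by (auto intro!: mult_mono powr_mono2)
    have "d (c g' x) (c g' y) \<le> max C C' * max r r' powr t"
      if "g' \<in> insert g F" "0 \<le> t" "x \<in> full_shift G A" "y \<in> full_shift G A"
        "\<forall>h\<in>carrier G. word_length G S h \<le> t \<longrightarrow> x h = y h" for g' x y and t :: real
    proof (cases "g' = g")
      case True
      then show ?thesis
        using g(4)[of t x y] le(2)[of t] that by fastforce
    next
      case False
      then have "d (c g' x) (c g' y) \<le> C * r powr t"
        using F that by blast
      then show ?thesis using le(1)[of t] that by linarith
    qed
    then show ?case
      using F g(1-3) by (intro exI[of _ "max C C'"] exI[of _ "max r r'"]) auto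
  qed
  then obtain C r where "?P F C r" by blast
  then show ?thesis by (intro that[of C r]) auto
qed

end

section \<open>Comparison of the cocycle with its values at a constant configuration\<close>

locale shift_cocycle = word_data G S + H: biinvariant_group H d
  for G :: "('g, 'm) monoid_scheme" and S and H :: "('h, 'k) monoid_scheme" and d +
  fixes A :: "'a set" and c :: "'g \<Rightarrow> ('g \<Rightarrow> 'a) \<Rightarrow> 'h" and a0 :: 'a
  assumes complete: "H.mcomplete"
    and hoelder: "hoelder_cocycle G S A H d c"
    and a0: "a0 \<in> A"
begin

abbreviation "X \<equiv> full_shift G A"
abbreviation "len \<equiv> word_length G S"

definition "x0 = (\<lambda>h\<in>carrier G. a0)"
definition "\<phi> g = c g x0"
definition "E x u = inv\<^bsub>H\<^esub> \<phi> u \<otimes>\<^bsub>H\<^esub> c u x"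
text \<open>Balls are finite, so these are the configurations that differ from \<open>x0\<close> at
  finitely many places.\<close>

definition "homoclinic x \<longleftrightarrow> x \<in> X \<and> (\<exists>R. \<forall>h\<in>carrier G. R < len h \<longrightarrow> x h = a0)"

lemma c_closed [simp]: "\<lbrakk>g \<in> carrier G; x \<in> X\<rbrakk> \<Longrightarrow> c g x \<in> carrier H"
  using hoelder by (simp add: hoelder_cocycle_def cocycle_def)

lemma c_mult:
  "\<lbrakk>g \<in> carrier G; h \<in> carrier G; x \<in> X\<rbrakk> \<Longrightarrow> c (g \<otimes>\<^bsub>G\<^esub> h) x = c g (shift G h x) \<otimes>\<^bsub>H\<^esub> c h x"
  using hoelder by (simp add: hoelder_cocycle_def cocycle_def)

lemma c_hoelder: "g \<in> carrier G \<Longrightarrow> hoelder_continuous G S A d (c g)"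
  using hoelder by (simp add: hoelder_cocycle_def)

lemma x0 [simp]: "x0 \<in> X" "g \<in> carrier G \<Longrightarrow> shift G g x0 = x0" "h \<in> carrier G \<Longrightarrow> x0 h = a0"
  using a0 by (auto simp: x0_def full_shift_def shift_def)

lemma \<phi>_hom: "\<phi> \<in> hom G H"
  by (simp add: hom_def \<phi>_def c_mult)

lemma \<phi>_closed [simp]: "g \<in> carrier G \<Longrightarrow> \<phi> g \<in> carrier H"
  by (simp add: \<phi>_def)

lemma \<phi>_mult: "\<lbrakk>g \<in> carrier G; h \<in> carrier G\<rbrakk> \<Longrightarrow> \<phi> (g \<otimes>\<^bsub>G\<^esub> h) = \<phi> g \<otimes>\<^bsub>H\<^esub> \<phi> h"
  by (simp add: \<phi>_def c_mult)

lemma E_closed [simp]: "\<lbrakk>u \<in> carrier G; x \<in> X\<rbrakk> \<Longrightarrow> E x u \<in> carrier H"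
  by (simp add: E_def)

text \<open>By the cocycle identity both elements carry the inverse of \<open>\<phi> u\<close> on
  the left and \<open>c u x\<close> on the right. Bi-invariance cancels these and then
  \<open>\<phi> v\<close>, leaving \<open>c v\<close> at two configurations.\<close>

lemma dist_E_step:
  assumes "v \<in> carrier G" "u \<in> carrier G" "x \<in> X"
  shows "d (E x (v \<otimes>\<^bsub>G\<^esub> u)) (E x u) = d (c v (shift G u x)) (c v x0)"
proof -
  have sx: "shift G u x \<in> X" using assms shift_closed by blast
  have "E x (v \<otimes>\<^bsub>G\<^esub> u) = inv\<^bsub>H\<^esub> \<phi> u \<otimes>\<^bsub>H\<^esub> ((inv\<^bsub>H\<^esub> \<phi> v \<otimes>\<^bsub>H\<^esub> c v (shift G u x)) \<otimes>\<^bsub>H\<^esub> c u x)"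
    using assms sx by (simp add: E_def c_mult \<phi>_mult H.inv_mult_group H.m_assoc)
  moreover have "E x u = inv\<^bsub>H\<^esub> \<phi> u \<otimes>\<^bsub>H\<^esub> ((inv\<^bsub>H\<^esub> \<phi> v \<otimes>\<^bsub>H\<^esub> \<phi> v) \<otimes>\<^bsub>H\<^esub> c u x)"
    using assms by (simp add: E_def)
  ultimately show ?thesis
    using assms sx by (simp only: H.left_invariant H.right_invariant H.inv_closed H.m_closed \<phi>_closed c_closed)
      (simp add: \<phi>_def[symmetric])
qed

text \<open>This rearranges the cocycle identity for \<open>u \<otimes> h\<close>. Its limit along
  powers of the undistorted element is the cohomology equation in \<open>b0_shift\<close>.\<close>

lemma E_shift:
  assumes "u \<in> carrier G" "h \<in> carrier G" "x \<in> X"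
  shows "E (shift G h x) u = \<phi> h \<otimes>\<^bsub>H\<^esub> E x (u \<otimes>\<^bsub>G\<^esub> h) \<otimes>\<^bsub>H\<^esub> inv\<^bsub>H\<^esub> c h x"
proof -
  have sx: "shift G h x \<in> X" using assms shift_closed by blast
  have cancel: "a \<otimes>\<^bsub>H\<^esub> (inv\<^bsub>H\<^esub> a \<otimes>\<^bsub>H\<^esub> y) = y" if "a \<in> carrier H" "y \<in> carrier H" for a y
    using that by (simp flip: H.m_assoc)
  have "\<phi> h \<otimes>\<^bsub>H\<^esub> E x (u \<otimes>\<^bsub>G\<^esub> h) = inv\<^bsub>H\<^esub> \<phi> u \<otimes>\<^bsub>H\<^esub> c u (shift G h x) \<otimes>\<^bsub>H\<^esub> c h x"
    using assms sx by (simp add: E_def c_mult \<phi>_mult H.inv_mult_group H.m_assoc cancel)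
  also have "\<dots> = E (shift G h x) u \<otimes>\<^bsub>H\<^esub> c h x"
    using assms sx by (simp add: E_def)
  finally show ?thesis
    using assms sx by (simp add: H.m_assoc)
qed

lemma homoclinic_shift:
  assumes h: "h \<in> carrier G" and "homoclinic x"
  shows "homoclinic (shift G h x)"
proof -
  obtain R where R: "\<And>q. \<lbrakk>q \<in> carrier G; R < len q\<rbrakk> \<Longrightarrow> x q = a0" and "x \<in> X"
    using assms(2) by (auto simp: homoclinic_def)
  have "shift G h x q = a0" if "q \<in> carrier G" "R + len h < len q" for q
    using that h word_length_mult_ge(2)[of "inv\<^bsub>G\<^esub> h" q] R[of "inv\<^bsub>G\<^esub> h \<otimes>\<^bsub>G\<^esub> q"]
    by (simp add: shift_apply word_length_inv)
  then show ?thesis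
    using shift_closed[OF h \<open>x \<in> X\<close>] by (auto simp: homoclinic_def)
qed

text \<open>A step from \<open>p\<close> to \<open>p \<otimes> a\<close> multiplies the inverse of
  \<open>p\<close> by that of \<open>a\<close> on the left, so \<open>dist_E_step\<close> applies.
  The shift of \<open>x\<close> by the inverse of \<open>p\<close> agrees with \<open>x0\<close> up
  to radius \<open>len p - (R + 1)\<close>, and Hoelder continuity gives the decay; the lost radius
  goes into the constant.\<close>

lemma slow_E:
  assumes "homoclinic x"
  shows "\<exists>C r R. slow_distance G S (\<lambda>p q. d (E x (inv\<^bsub>G\<^esub> p)) (E x (inv\<^bsub>G\<^esub> q))) C r R"
proof -
  obtain R where R: "\<And>q. \<lbrakk>q \<in> carrier G; R < len q\<rbrakk> \<Longrightarrow> x q = a0" and x: "x \<in> X"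
    using assms by (auto simp: homoclinic_def)
  have fin: "finite (m_inv G ` S)" and inS: "\<And>a. a \<in> S \<Longrightarrow> a \<in> carrier G"
    using gens by (auto simp: finite_symmetric_generating_set_def)
  obtain C r where C: "0 < C" "0 < r" "r < 1" and le:
    "\<And>g (t::real) x y. \<lbrakk>g \<in> m_inv G ` S; 0 \<le> t; x \<in> X; y \<in> X;
       \<And>h. \<lbrakk>h \<in> carrier G; len h \<le> t\<rbrakk> \<Longrightarrow> x h = y h\<rbrakk> \<Longrightarrow> d (c g x) (c g y) \<le> C * r powr t"
    using uniform_hoelder_continuous[OF fin, of A d c] c_hoelder inS by blast
  have "slow_distance G S (\<lambda>p q. d (E x (inv\<^bsub>G\<^esub> p)) (E x (inv\<^bsub>G\<^esub> q))) (C / r ^ (R + 1)) r R"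
  proof unfold_locales
    fix p a assume p: "p \<in> carrier G" and a: "a \<in> S" and far: "R < len p"
    have "d (E x (inv\<^bsub>G\<^esub> p)) (E x (inv\<^bsub>G\<^esub> (p \<otimes>\<^bsub>G\<^esub> a)))
        = d (c (inv\<^bsub>G\<^esub> a) (shift G (inv\<^bsub>G\<^esub> p) x)) (c (inv\<^bsub>G\<^esub> a) x0)"
      using dist_E_step[of "inv\<^bsub>G\<^esub> a" "inv\<^bsub>G\<^esub> p" x] p inS[OF a] x
      by (simp add: inv_mult_group H.commute)
    also have "\<dots> \<le> C * r powr (real (len p) - (R + 1))"
    proof (rule le)
      fix h assume h: "h \<in> carrier G" "len h \<le> real (len p) - (R + 1)"
      have "R < len (p \<otimes>\<^bsub>G\<^esub> h)"
        using word_length_mult_ge(1)[OF p h(1)] h(2) by linarith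
      then show "shift G (inv\<^bsub>G\<^esub> p) x h = x0 h"
        using p h R by (simp add: shift_apply)
    qed (use p a x far in \<open>auto intro: shift_closed\<close>)
    also have "\<dots> = C / r ^ (R + 1) * r ^ len p"
      using C by (simp add: powr_diff powr_realpow powr_add)
    finally show "d (E x (inv\<^bsub>G\<^esub> p)) (E x (inv\<^bsub>G\<^esub> (p \<otimes>\<^bsub>G\<^esub> a))) \<le> C / r ^ (R + 1) * r ^ len p" .
  qed (use C x in \<open>auto simp: H.commute intro: H.triangle\<close>)
  then show ?thesis by blast
qed

end

section \<open>The transfer function\<close>

locale wide_shift_cocycle = shift_cocycle G S H d A c a0
  for G :: "('g, 'm) monoid_scheme" and S and H :: "('h, 'k) monoid_scheme" and d
    and A :: "'a set" and c a0 +
  fixes g :: 'g and l :: real and \<omega> :: "nat filter"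
  assumes wide: "wide G S"
    and g [simp]: "g \<in> carrier G"
    and l: "0 < l"
    and g_undistorted: "\<And>n. l * real n \<le> word_length G S (g [^]\<^bsub>G\<^esub> n)"
    and ultra: "nonprincipal_ultrafilter \<omega>"
begin

lemma \<omega>: "\<omega> \<noteq> bot" "\<omega> \<le> sequentially"
  using ultra nonprincipal_ultrafilter_le_sequentially by (auto simp: nonprincipal_ultrafilter_def)

lemma homoclinic_in_X: "homoclinic x \<Longrightarrow> x \<in> X"
  by (simp add: homoclinic_def)

text \<open>Undistortion makes the shift of \<open>x\<close> by the \<open>k\<close>-th power of
  \<open>g\<close> agree with \<open>x0\<close> up to radius \<open>l * k - (R + 1)\<close>. So once
  this radius is nonnegative, the increments decay with ratio \<open>r powr l\<close>.\<close>

lemma E_pow_converges: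
  assumes "homoclinic x"
  shows "\<exists>b\<in>carrier H. (\<lambda>k::nat. d (E x (g [^]\<^bsub>G\<^esub> k)) b) \<longlonglongrightarrow> 0"
proof -
  obtain R where R: "\<And>q. \<lbrakk>q \<in> carrier G; R < len q\<rbrakk> \<Longrightarrow> x q = a0" and x: "x \<in> X"
    using assms by (auto simp: homoclinic_def)
  obtain C r where C: "0 < C" "0 < r" "r < 1" and le:
    "\<And>(t::real) x y. \<lbrakk>0 \<le> t; x \<in> X; y \<in> X;
       \<And>h. \<lbrakk>h \<in> carrier G; len h \<le> t\<rbrakk> \<Longrightarrow> x h = y h\<rbrakk> \<Longrightarrow> d (c g x) (c g y) \<le> C * r powr t"
    using hoelder_continuous_powr[OF c_hoelder[OF g]] by blast
  show ?thesis
  proof (rule H.mcomplete_geometric_limit[OF complete,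
        where q = "r powr l" and K = "C * r powr - (R + 1)" and N = "nat \<lceil>(R + 1) / l\<rceil>"])
    show "r powr l < 1"
      using C l powr_less_mono'[of r 0 l] by simp
    fix k assume "nat \<lceil>(R + 1) / l\<rceil> \<le> k"
    then have "(R + 1) / l \<le> k"
      by linarith
    then have k: "R + 1 \<le> l * k"
      using l by (simp add: field_simps)
    have "d (E x (g [^]\<^bsub>G\<^esub> k)) (E x (g [^]\<^bsub>G\<^esub> Suc k)) = d (c g (shift G (g [^]\<^bsub>G\<^esub> k) x)) (c g x0)"
      using dist_E_step[of g "g [^]\<^bsub>G\<^esub> k" x] x nat_pow_Suc2[OF g, of k] by (simp add: H.commute del: nat_pow_Suc)
    also have "\<dots> \<le> C * r powr (l * k - (R + 1))"
    proof (rule le)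
      fix h assume h: "h \<in> carrier G" "len h \<le> l * k - real (R + 1)"
      have "R < len (inv\<^bsub>G\<^esub> (g [^]\<^bsub>G\<^esub> k) \<otimes>\<^bsub>G\<^esub> h)"
        using word_length_mult_ge(1)[of "inv\<^bsub>G\<^esub> (g [^]\<^bsub>G\<^esub> k)" h] g_undistorted[of k] h
        by (simp add: word_length_inv)
      then show "shift G (g [^]\<^bsub>G\<^esub> k) x h = x0 h"
        using h R by (simp add: shift_apply)
    qed (use k x in \<open>auto intro: shift_closed\<close>)
    also have "\<dots> = C * r powr - (R + 1) * (r powr l) ^ k"
      using C by (simp add: powr_powr flip: powr_add powr_realpow) (simp add: algebra_simps)
    finally show "d (E x (g [^]\<^bsub>G\<^esub> k)) (E x (g [^]\<^bsub>G\<^esub> Suc k)) \<le> C * r powr - (R + 1) * (r powr l) ^ k" .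
  qed (use C x in auto)
qed

definition "b0 x = (SOME b. b \<in> carrier H \<and> (\<lambda>k::nat. d (E x (g [^]\<^bsub>G\<^esub> k)) b) \<longlonglongrightarrow> 0)"

lemma b0:
  assumes "homoclinic x"
  shows "b0 x \<in> carrier H" "(\<lambda>k::nat. d (E x (g [^]\<^bsub>G\<^esub> k)) (b0 x)) \<longlonglongrightarrow> 0"
proof -
  have "b0 x \<in> carrier H \<and> (\<lambda>k::nat. d (E x (g [^]\<^bsub>G\<^esub> k)) (b0 x)) \<longlonglongrightarrow> 0"
    unfolding b0_def by (rule someI_ex) (use E_pow_converges[OF assms] in blast)
  then show "b0 x \<in> carrier H" "(\<lambda>k::nat. d (E x (g [^]\<^bsub>G\<^esub> k)) (b0 x)) \<longlonglongrightarrow> 0" by auto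
qed

text \<open>The growth of the powers of \<open>g\<close> up to a bounded error, as required by
  \<open>wide_slow_limit\<close>. The error \<open>k\<close> leaves room for multiplication by a
  fixed element.\<close>

definition ray :: "(nat \<Rightarrow> 'g) \<Rightarrow> bool" where
  "ray u \<longleftrightarrow> (\<forall>n. u n \<in> carrier G) \<and>
     (\<exists>k\<ge>0. \<forall>n. l * real n - k \<le> len (u n) \<and> len (u n) \<le> len g * real n + k)"

lemma len_pow_le: "len (g [^]\<^bsub>G\<^esub> n) \<le> len g * real n" for n :: nat
  using word_length_pow_le[OF g, of n] by (simp add: mult.commute flip: of_nat_mult)

lemma ray_pow_mult:
  assumes h: "h \<in> carrier G"
  shows "ray (\<lambda>n. g [^]\<^bsub>G\<^esub> n \<otimes>\<^bsub>G\<^esub> h)"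
proof -
  have "l * real n - len h \<le> len (g [^]\<^bsub>G\<^esub> n \<otimes>\<^bsub>G\<^esub> h) \<and>
      len (g [^]\<^bsub>G\<^esub> n \<otimes>\<^bsub>G\<^esub> h) \<le> len g * real n + len h" for n
    using word_length_mult_ge(1)[of "g [^]\<^bsub>G\<^esub> n" h] word_length_mult_le[of "g [^]\<^bsub>G\<^esub> n" h]
      h g_undistorted[of n] len_pow_le[of n] by simp
  with h show ?thesis
    unfolding ray_def by (intro conjI exI[of _ "real (len h)"]) auto
qed

lemma ray_pow: "ray (\<lambda>n. g [^]\<^bsub>G\<^esub> n)"
  using ray_pow_mult[of "\<one>\<^bsub>G\<^esub>"] by simp

lemma ray_inv_pow: "ray (\<lambda>n. (inv\<^bsub>G\<^esub> g) [^]\<^bsub>G\<^esub> n)"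
  unfolding ray_def using g_undistorted len_pow_le
  by (intro conjI exI[of _ 0]) (auto simp: nat_pow_inv word_length_inv)

text \<open>Here wideness enters: along \<open>\<omega>\<close> every ray gives the same limit as
  the powers of \<open>g\<close>, through which \<open>b0\<close> was chosen.\<close>

lemma b0_along_ray:
  assumes x: "homoclinic x" and "ray u"
  shows "((\<lambda>n. d (E x (u n)) (b0 x)) \<longlongrightarrow> 0) \<omega>"
proof -
  obtain k where k: "0 \<le> k" and u: "\<And>n. u n \<in> carrier G" "\<And>n. l * real n - k \<le> len (u n)"
    "\<And>n. len (u n) \<le> len g * real n + k"
    using \<open>ray u\<close> unfolding ray_def by blast
  have pow: "l * real n - k \<le> len (g [^]\<^bsub>G\<^esub> n)" "len (g [^]\<^bsub>G\<^esub> n) \<le> len g * real n + k" for n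
    using g_undistorted[of n] len_pow_le[of n] k by auto
  obtain C r R where slow: "slow_distance G S (\<lambda>p q. d (E x (inv\<^bsub>G\<^esub> p)) (E x (inv\<^bsub>G\<^esub> q))) C r R"
    using slow_E[OF x] by blast
  \<comment> \<open>\<open>slow_E\<close> speaks of inverses, so the sequences fed to
    \<open>wide_slow_limit\<close> are inverted; this preserves word length.\<close>
  have "((\<lambda>n. d (E x (u n)) (E x (g [^]\<^bsub>G\<^esub> n))) \<longlongrightarrow> 0) \<omega>"
    using wide_slow_limit[OF wide ultra slow, where p = "\<lambda>n. inv\<^bsub>G\<^esub> u n"
        and q = "\<lambda>n. inv\<^bsub>G\<^esub> (g [^]\<^bsub>G\<^esub> n)" and l = l and k = k and K = "len g"] u pow k l
    by (simp add: word_length_inv)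
  moreover have "((\<lambda>n. d (E x (g [^]\<^bsub>G\<^esub> n)) (b0 x)) \<longlongrightarrow> 0) \<omega>"
    using b0(2)[OF x] \<omega>(2) by (rule filterlim_mono[OF _ order_refl])
  ultimately have "((\<lambda>n. d (E x (u n)) (E x (g [^]\<^bsub>G\<^esub> n)) + d (E x (g [^]\<^bsub>G\<^esub> n)) (b0 x)) \<longlongrightarrow> 0) \<omega>"
    using tendsto_add by fastforce
  then show ?thesis
    by (rule real_tendsto_sandwich[OF always_eventually always_eventually tendsto_const[of 0], rotated 2])
      (use u x b0 homoclinic_in_X in \<open>auto intro: H.triangle\<close>)
qed

text \<open>Put powers of \<open>g\<close> for \<open>u\<close> in \<open>E_shift\<close>. The
  right-hand side then runs along these powers times \<open>h\<close>, which is again a ray, so both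
  sides converge to values of \<open>b0\<close>.\<close>

lemma b0_shift:
  assumes x: "homoclinic x" and h: "h \<in> carrier G"
  shows "c h x = inv\<^bsub>H\<^esub> b0 (shift G h x) \<otimes>\<^bsub>H\<^esub> \<phi> h \<otimes>\<^bsub>H\<^esub> b0 x"
proof -
  have hx: "homoclinic (shift G h x)"
    using homoclinic_shift x h by blast
  have X: "x \<in> X" "shift G h x \<in> X"
    using x hx homoclinic_in_X by auto
  have "b0 (shift G h x) = \<phi> h \<otimes>\<^bsub>H\<^esub> b0 x \<otimes>\<^bsub>H\<^esub> inv\<^bsub>H\<^esub> c h x"
  proof (rule H.limit_unique[OF \<omega>(1)])
    let ?f = "\<lambda>n::nat. d (E (shift G h x) (g [^]\<^bsub>G\<^esub> n)) (b0 (shift G h x))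
                + d (E x (g [^]\<^bsub>G\<^esub> n \<otimes>\<^bsub>G\<^esub> h)) (b0 x)"
    show "(?f \<longlongrightarrow> 0) \<omega>"
      using tendsto_add[OF b0_along_ray[OF hx ray_pow] b0_along_ray[OF x ray_pow_mult[OF h]]] by simp
    show "eventually (\<lambda>n. d (b0 (shift G h x)) (\<phi> h \<otimes>\<^bsub>H\<^esub> b0 x \<otimes>\<^bsub>H\<^esub> inv\<^bsub>H\<^esub> c h x) \<le> ?f n) \<omega>"
    proof (intro always_eventually allI)
      fix n :: nat
      have "d (E (shift G h x) (g [^]\<^bsub>G\<^esub> n)) (\<phi> h \<otimes>\<^bsub>H\<^esub> b0 x \<otimes>\<^bsub>H\<^esub> inv\<^bsub>H\<^esub> c h x)
          = d (E x (g [^]\<^bsub>G\<^esub> n \<otimes>\<^bsub>G\<^esub> h)) (b0 x)"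
        using X h b0(1)[OF x] by (simp add: E_shift H.left_invariant H.right_invariant)
      then show "d (b0 (shift G h x)) (\<phi> h \<otimes>\<^bsub>H\<^esub> b0 x \<otimes>\<^bsub>H\<^esub> inv\<^bsub>H\<^esub> c h x) \<le> ?f n"
        using H.triangle[of "b0 (shift G h x)" "E (shift G h x) (g [^]\<^bsub>G\<^esub> n)"
            "\<phi> h \<otimes>\<^bsub>H\<^esub> b0 x \<otimes>\<^bsub>H\<^esub> inv\<^bsub>H\<^esub> c h x"] X h b0(1)[OF x] b0(1)[OF hx]
        by (simp add: H.commute[of "b0 (shift G h x)"])
    qed
  qed (use X h b0(1)[OF x] b0(1)[OF hx] in auto)
  then have "b0 (shift G h x) \<otimes>\<^bsub>H\<^esub> c h x = \<phi> h \<otimes>\<^bsub>H\<^esub> b0 x"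
    using X h b0(1)[OF x] by (simp add: H.m_assoc)
  then have "c h x = inv\<^bsub>H\<^esub> b0 (shift G h x) \<otimes>\<^bsub>H\<^esub> (\<phi> h \<otimes>\<^bsub>H\<^esub> b0 x)"
    using X h b0(1)[OF x] b0(1)[OF hx] by (metis H.inv_solve_left H.m_closed c_closed \<phi>_closed)
  then show ?thesis
    using X h b0(1)[OF x] b0(1)[OF hx] by (simp add: H.m_assoc)
qed

section \<open>Hoelder estimate for the transfer function on homoclinic configurations\<close>

lemma dist_b0_le:
  assumes x: "homoclinic x" and y: "homoclinic y" and u: "ray u"
    and le: "\<And>n. d (c (u n) x) (c (u n) y) \<le> K"
  shows "d (b0 x) (b0 y) \<le> K"
proof (rule tendsto_lowerbound[OF _ _ \<omega>(1)])
  let ?f = "\<lambda>n. d (E x (u n)) (b0 x) + K + d (E y (u n)) (b0 y)"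
  have "(?f \<longlongrightarrow> 0 + K + 0) \<omega>"
    by (intro tendsto_intros b0_along_ray x y u)
  then show "(?f \<longlongrightarrow> K) \<omega>" by simp
  show "eventually (\<lambda>n. d (b0 x) (b0 y) \<le> ?f n) \<omega>"
  proof (intro always_eventually allI)
    fix n
    have u_closed: "u n \<in> carrier G" using u by (simp add: ray_def)
    have X: "x \<in> X" "y \<in> X" using x y homoclinic_in_X by auto
    \<comment> \<open>\<open>E x\<close> and \<open>E y\<close> share the left factor coming from
      \<open>\<phi> (u n)\<close>, which left invariance removes.\<close>
    have "d (E x (u n)) (E y (u n)) = d (c (u n) x) (c (u n) y)"
      using u_closed X by (simp add: E_def H.left_invariant)
    then show "d (b0 x) (b0 y) \<le> ?f n"
      using H.triangle[of "b0 x" "E x (u n)" "b0 y"] H.triangle[of "E x (u n)" "E y (u n)" "b0 y"]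
        le[of n] b0(1)[OF x] b0(1)[OF y] u_closed X H.commute[of "b0 x" "E x (u n)"] by simp
  qed
qed

text \<open>The cocycle at a power of \<open>v\<close> is a product of values of \<open>c v\<close>
  along the orbit, and distances of factors add up by \<open>dist_mult_le\<close>. The radius of
  agreement grows by \<open>\<epsilon>\<close> with each power, so a geometric series bounds the sum
  independently of \<open>k\<close>.\<close>

lemma dist_c_along_powers:
  fixes C r \<epsilon> \<tau> :: real
  assumes v: "v \<in> carrier G" and X: "x \<in> X" "y \<in> X"
    and C: "0 < C" "0 < r" "r < 1" "0 < \<epsilon>" "0 \<le> \<tau>"
    and le: "\<And>(t::real) x y. \<lbrakk>0 \<le> t; x \<in> X; y \<in> X;
       \<And>h. \<lbrakk>h \<in> carrier G; len h \<le> t\<rbrakk> \<Longrightarrow> x h = y h\<rbrakk> \<Longrightarrow> d (c v x) (c v y) \<le> C * r powr t"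
    and agree: "\<And>(k::nat) h. \<lbrakk>h \<in> carrier G; len h \<le> \<epsilon> * k + \<tau>\<rbrakk>
       \<Longrightarrow> x (inv\<^bsub>G\<^esub> (v [^]\<^bsub>G\<^esub> k) \<otimes>\<^bsub>G\<^esub> h) = y (inv\<^bsub>G\<^esub> (v [^]\<^bsub>G\<^esub> k) \<otimes>\<^bsub>G\<^esub> h)"
  shows "d (c (v [^]\<^bsub>G\<^esub> (k::nat)) x) (c (v [^]\<^bsub>G\<^esub> k) y) \<le> C / (1 - r powr \<epsilon>) * r powr \<tau>"
proof -
  let ?q = "r powr \<epsilon>"
  have q: "0 < ?q" "?q < 1"
    using C powr_less_mono'[of r 0 \<epsilon>] by auto
  have "d (c (v [^]\<^bsub>G\<^esub> k) x) (c (v [^]\<^bsub>G\<^esub> k) y) \<le> C * r powr \<tau> * (\<Sum>i<k. ?q ^ i)"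
  proof (induction k)
    case 0
    have "c \<one>\<^bsub>G\<^esub> z = \<one>\<^bsub>H\<^esub>" if "z \<in> X" for z
    proof -
      have "shift G \<one>\<^bsub>G\<^esub> z = z"
        using that by (auto simp: shift_def full_shift_def PiE_iff extensional_def)
      then have "c \<one>\<^bsub>G\<^esub> z \<otimes>\<^bsub>H\<^esub> c \<one>\<^bsub>G\<^esub> z = c \<one>\<^bsub>G\<^esub> z"
        using c_mult[of "\<one>\<^bsub>G\<^esub>" "\<one>\<^bsub>G\<^esub>" z] that by simp
      then show ?thesis
        using that by (metis H.l_cancel_one c_closed one_closed)
    qed
    then show ?case using X by simp
  next
    case (Suc k)
    let ?w = "v [^]\<^bsub>G\<^esub> k"
    have w: "?w \<in> carrier G" using v by simp
    note sX = shift_closed[OF w X(1)] shift_closed[OF w X(2)]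
    have "d (c v (shift G ?w x)) (c v (shift G ?w y)) \<le> C * r powr (\<epsilon> * k + \<tau>)"
      using C by (intro le sX) (auto simp: shift_apply intro!: agree)
    also have "\<dots> = C * r powr \<tau> * ?q ^ k"
      using C by (simp add: powr_add powr_powr flip: powr_realpow)
    finally have step: "d (c v (shift G ?w x)) (c v (shift G ?w y)) \<le> C * r powr \<tau> * ?q ^ k" .
    have "d (c (v [^]\<^bsub>G\<^esub> Suc k) x) (c (v [^]\<^bsub>G\<^esub> Suc k) y)
        \<le> d (c v (shift G ?w x)) (c v (shift G ?w y)) + d (c ?w x) (c ?w y)"
      using v w X sX nat_pow_Suc2[OF v, of k]
      by (simp add: c_mult H.dist_mult_le del: nat_pow_Suc)
    with step Suc show ?case by (simp add: algebra_simps)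
  qed
  also have "(\<Sum>i<k. ?q ^ i) \<le> 1 / (1 - ?q)"
    using q sum_le_suminf[of "\<lambda>i. ?q ^ i" "{..<k}"] by (simp add: suminf_geometric summable_geometric)
  finally show ?thesis
    using C by (simp add: mult_ac mult_left_mono)
qed

text \<open>\<open>b0\<close> may be computed along positive or along negative powers of
  \<open>g\<close>. A hybrid configuration \<open>z\<close> is compared with \<open>x\<close> by the
  former and with \<open>y\<close> by the latter, and each comparison is an instance of
  \<open>dist_c_along_powers\<close>.\<close>

lemma b0_hoelder:
  "\<exists>C r. 0 < C \<and> 0 < r \<and> r < 1 \<and>
     (\<forall>n x y. homoclinic x \<longrightarrow> homoclinic y \<longrightarrow> (\<forall>q\<in>word_ball G S n. x q = y q) \<longrightarrow>
        d (b0 x) (b0 y) \<le> C * r ^ n)"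
proof -
  have fin: "finite {g, inv\<^bsub>G\<^esub> g}" by simp
  have hold: "hoelder_continuous G S A d (c v)" if "v \<in> {g, inv\<^bsub>G\<^esub> g}" for v
    using c_hoelder that by auto
  obtain C r where C: "0 < C" "0 < r" "r < 1" and le:
    "\<And>v (t::real) x y. \<lbrakk>v \<in> {g, inv\<^bsub>G\<^esub> g}; 0 \<le> t; x \<in> X; y \<in> X;
       \<And>h. \<lbrakk>h \<in> carrier G; len h \<le> t\<rbrakk> \<Longrightarrow> x h = y h\<rbrakk> \<Longrightarrow> d (c v x) (c v y) \<le> C * r powr t"
    using uniform_hoelder_continuous[OF fin, of A d c] hold by blast
  \<comment> \<open>With half the growth rate as opening, a common point of the cones around the two
    rays, at parameters \<open>j\<close> and \<open>k\<close>, satisfies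
    \<open>l * (j + k) \<le> l / 2 * (j + k) + 2 * \<tau>\<close>, whence
    \<open>j \<le> 4 * \<tau> / l\<close>.\<close>
  define \<epsilon> where "\<epsilon> = l / 2"
  \<comment> \<open>Such a common point has length at most
    \<open>(len g + \<epsilon>) * j + \<tau>\<close>, hence at most \<open>D * \<tau>\<close>.
    Taking \<open>\<tau> = n / D\<close> therefore puts it in the ball of radius \<open>n\<close>,
    where \<open>x\<close> and \<open>y\<close> agree.\<close>
  define D where "D = (len g + \<epsilon>) * 4 / l + 1"
  define \<delta> where "\<delta> = 1 / D"
  have \<epsilon>: "0 < \<epsilon>" and D: "1 \<le> D"
    using l by (auto simp: \<epsilon>_def D_def)
  then have \<delta>: "0 < \<delta>" "D * \<delta> = 1"
    by (auto simp: \<delta>_def)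
  define C' where "C' = 2 * (C / (1 - r powr \<epsilon>))"
  have "r powr \<epsilon> < 1" "r powr \<delta> < 1"
    using C \<epsilon> \<delta> powr_less_mono'[of r 0 \<epsilon>] powr_less_mono'[of r 0 \<delta>] by auto
  then have "0 < C'" using C by (simp add: C'_def)
  have "d (b0 x) (b0 y) \<le> C' * (r powr \<delta>) ^ n"
    if x: "homoclinic x" and y: "homoclinic y" and agree: "\<And>q. \<lbrakk>q \<in> carrier G; len q \<le> n\<rbrakk> \<Longrightarrow> x q = y q"
    for n x y
  proof -
    define \<tau> where "\<tau> = \<delta> * n"
    have \<tau>: "0 \<le> \<tau>" using \<delta> by (simp add: \<tau>_def)
    define N where "N = {q. \<exists>j::nat. len (g [^]\<^bsub>G\<^esub> j \<otimes>\<^bsub>G\<^esub> q) \<le> \<epsilon> * j + \<tau>}"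
    \<comment> \<open>\<open>N\<close> is a conical neighbourhood of the negative ray of \<open>g\<close>. Outside the ball of radius \<open>n\<close> it
      stays away from the positive ray, because \<open>g\<close> is undistorted; so \<open>z\<close> is close to \<open>x\<close> when moved
      by positive powers of \<open>g\<close>, and close to \<open>y\<close> when moved by negative ones.\<close>
    define z where "z = (\<lambda>q\<in>carrier G. if q \<in> N then x q else y q)"
    have X: "x \<in> X" "y \<in> X" using x y homoclinic_in_X by auto
    then have zX: "z \<in> X" by (auto simp: z_def full_shift_def PiE_iff)
    have z: "homoclinic z"
    proof -
      obtain R R' where "\<And>q. \<lbrakk>q \<in> carrier G; R < len q\<rbrakk> \<Longrightarrow> x q = a0"
        "\<And>q. \<lbrakk>q \<in> carrier G; R' < len q\<rbrakk> \<Longrightarrow> y q = a0"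
        using x y by (auto simp: homoclinic_def)
      then have "\<forall>q\<in>carrier G. max R R' < len q \<longrightarrow> z q = a0"
        by (simp add: z_def)
      with zX show ?thesis unfolding homoclinic_def by blast
    qed
    have "d (b0 x) (b0 z) \<le> C / (1 - r powr \<epsilon>) * r powr \<tau>"
    proof (rule dist_b0_le[OF x z ray_pow], rule dist_c_along_powers[OF g X(1) zX C \<epsilon> \<tau>])
      fix h and j :: nat assume h: "h \<in> carrier G" "len h \<le> \<epsilon> * j + \<tau>"
      have "g [^]\<^bsub>G\<^esub> j \<otimes>\<^bsub>G\<^esub> (inv\<^bsub>G\<^esub> (g [^]\<^bsub>G\<^esub> j) \<otimes>\<^bsub>G\<^esub> h) = h"
        using h by (simp flip: m_assoc)
      then have "inv\<^bsub>G\<^esub> (g [^]\<^bsub>G\<^esub> j) \<otimes>\<^bsub>G\<^esub> h \<in> N"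
        using h(2) unfolding N_def by (auto intro!: exI[of _ j])
      then show "x (inv\<^bsub>G\<^esub> (g [^]\<^bsub>G\<^esub> j) \<otimes>\<^bsub>G\<^esub> h) = z (inv\<^bsub>G\<^esub> (g [^]\<^bsub>G\<^esub> j) \<otimes>\<^bsub>G\<^esub> h)"
        using h(1) by (simp add: z_def)
    qed (use le in auto)
    moreover have "d (b0 z) (b0 y) \<le> C / (1 - r powr \<epsilon>) * r powr \<tau>"
    proof (rule dist_b0_le[OF z y ray_inv_pow], rule dist_c_along_powers[OF inv_closed[OF g] zX X(2) C \<epsilon> \<tau>])
      fix h and k :: nat assume h: "h \<in> carrier G" "len h \<le> \<epsilon> * k + \<tau>"
      define q where "q = g [^]\<^bsub>G\<^esub> k \<otimes>\<^bsub>G\<^esub> h"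
      have q: "q \<in> carrier G" using h by (simp add: q_def)
      have "z q = y q"
      proof (cases "q \<in> N")
        case True
        then obtain j :: nat where j: "len (g [^]\<^bsub>G\<^esub> j \<otimes>\<^bsub>G\<^esub> q) \<le> \<epsilon> * j + \<tau>"
          by (auto simp: N_def)
        have "g [^]\<^bsub>G\<^esub> j \<otimes>\<^bsub>G\<^esub> q = g [^]\<^bsub>G\<^esub> (j + k) \<otimes>\<^bsub>G\<^esub> h"
          using h by (simp add: q_def m_assoc flip: nat_pow_mult)
        then have "len (g [^]\<^bsub>G\<^esub> (j + k)) \<le> len (g [^]\<^bsub>G\<^esub> j \<otimes>\<^bsub>G\<^esub> q) + len h"
          using word_length_mult_ge(1)[of "g [^]\<^bsub>G\<^esub> (j + k)" h] h by simp
        then have "l * real (j + k) \<le> \<epsilon> * j + \<tau> + (\<epsilon> * k + \<tau>)"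
          using g_undistorted[of "j + k"] j h(2) by linarith
        moreover have "0 \<le> l * real k" using l by simp
        ultimately have "l * j \<le> 4 * \<tau>"
          by (simp add: \<epsilon>_def algebra_simps)
        then have j_le: "real j \<le> 4 * \<tau> / l"
          using l by (simp add: field_simps)
        have "len q \<le> len (g [^]\<^bsub>G\<^esub> j \<otimes>\<^bsub>G\<^esub> q) + len (g [^]\<^bsub>G\<^esub> j)"
          using word_length_mult_ge(2)[of "g [^]\<^bsub>G\<^esub> j" q] q by simp
        then have "len q \<le> (\<epsilon> * j + \<tau>) + len g * real j"
          using j len_pow_le[of j] by linarith
        also have "\<dots> = (len g + \<epsilon>) * j + \<tau>"
          by (simp add: algebra_simps)
        also have "\<dots> \<le> (len g + \<epsilon>) * (4 * \<tau> / l) + \<tau>"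
          using j_le \<epsilon> by (intro add_right_mono mult_left_mono) auto
        also have "\<dots> = D * \<delta> * n"
          by (simp add: D_def \<tau>_def algebra_simps)
        finally have "x q = y q"
          using agree[OF q] \<delta> by simp
        then show ?thesis using q by (simp add: z_def)
      qed (use q in \<open>simp add: z_def\<close>)
      then show "z (inv\<^bsub>G\<^esub> ((inv\<^bsub>G\<^esub> g) [^]\<^bsub>G\<^esub> k) \<otimes>\<^bsub>G\<^esub> h) = y (inv\<^bsub>G\<^esub> ((inv\<^bsub>G\<^esub> g) [^]\<^bsub>G\<^esub> k) \<otimes>\<^bsub>G\<^esub> h)"
        by (simp add: q_def nat_pow_inv)
    qed (use le in auto)
    ultimately have "d (b0 x) (b0 y) \<le> C' * r powr \<tau>"
      using H.triangle[of "b0 x" "b0 z" "b0 y"] b0(1)[OF x] b0(1)[OF y] b0(1)[OF z]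
      by (simp add: C'_def)
    also have "r powr \<tau> = (r powr \<delta>) ^ n"
      using C by (simp add: \<tau>_def powr_powr flip: powr_realpow)
    finally show ?thesis .
  qed
  then show ?thesis
    using \<open>0 < C'\<close> \<open>r powr \<delta> < 1\<close> C by (intro exI[of _ C'] exI[of _ "r powr \<delta>"]) (auto simp: word_ball_def)
qed

section \<open>Extension from homoclinic to all configurations by truncation\<close>

definition "trunc n x = (\<lambda>q\<in>carrier G. if len q \<le> n then x q else a0)" for n :: nat

lemma homoclinic_trunc: "x \<in> X \<Longrightarrow> homoclinic (trunc n x)"
  using a0 unfolding homoclinic_def trunc_def
  by (intro conjI exI[of _ n]) (auto simp: full_shift_def PiE_iff)

lemma trunc_in_X: "x \<in> X \<Longrightarrow> trunc n x \<in> X"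
  using homoclinic_trunc homoclinic_in_X by blast

lemma trunc_apply: "\<lbrakk>q \<in> carrier G; len q \<le> n\<rbrakk> \<Longrightarrow> trunc n x q = x q"
  by (simp add: trunc_def)

text \<open>Successive truncations agree on growing balls, so the estimate for \<open>b0\<close>
  makes its values on them converge geometrically. The limit \<open>b\<close> inherits the constants
  \<open>C\<close> and \<open>r\<close>, and the cohomology equation passes to the limit.\<close>

lemma cohomologous_to_hom: "hoelder_cohomologous G S A H d c (\<lambda>h x. \<phi> h)"
proof -
  obtain C r where C: "0 < C" "0 < r" "r < 1" and le:
    "\<And>n x y. \<lbrakk>homoclinic x; homoclinic y; \<forall>q\<in>word_ball G S n. x q = y q\<rbrakk>
      \<Longrightarrow> d (b0 x) (b0 y) \<le> C * r ^ n"
    using b0_hoelder by blast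
  have b0_closed: "b0 (trunc n x) \<in> carrier H" if "x \<in> X" for n x
    using b0(1) homoclinic_trunc that by blast
  have "\<exists>b\<in>carrier H. (\<lambda>n. d (b0 (trunc n x)) b) \<longlonglongrightarrow> 0" if x: "x \<in> X" for x
  proof (rule H.mcomplete_geometric_limit[OF complete, where q = r and K = C and N = 0])
    fix n
    show "d (b0 (trunc n x)) (b0 (trunc (Suc n) x)) \<le> C * r ^ n"
      by (rule le) (use x homoclinic_trunc in \<open>auto simp: word_ball_def trunc_apply\<close>)
  qed (use C x b0_closed in auto)
  then obtain b where b: "\<And>x. x \<in> X \<Longrightarrow> b x \<in> carrier H"
    and lim: "\<And>x. x \<in> X \<Longrightarrow> (\<lambda>n. d (b0 (trunc n x)) (b x)) \<longlonglongrightarrow> 0"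
    by metis
  have "d (b x) (b y) \<le> C * r ^ n"
    if x: "x \<in> X" and y: "y \<in> X" and agree: "\<forall>q\<in>word_ball G S n. x q = y q" for n x y
  proof (rule tendsto_lowerbound[OF _ _ sequentially_bot])
    let ?f = "\<lambda>m. d (b0 (trunc m x)) (b x) + C * r ^ n + d (b0 (trunc m y)) (b y)"
    have "?f \<longlonglongrightarrow> 0 + C * r ^ n + 0"
      by (intro tendsto_intros lim x y)
    then show "?f \<longlonglongrightarrow> C * r ^ n" by simp
    show "eventually (\<lambda>m. d (b x) (b y) \<le> ?f m) sequentially"
    proof (intro always_eventually allI)
      fix m
      \<comment> \<open>Truncation at a common radius preserves agreement on the ball of radius
        \<open>n\<close>, also for \<open>m < n\<close>, where both configurations take the value
        \<open>a0\<close> beyond \<open>m\<close>.\<close>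
      have "d (b0 (trunc m x)) (b0 (trunc m y)) \<le> C * r ^ n"
        by (rule le) (use x y agree homoclinic_trunc in \<open>auto simp: word_ball_def trunc_def\<close>)
      then show "d (b x) (b y) \<le> ?f m"
        using H.triangle[of "b x" "b0 (trunc m x)" "b y"] b[OF x] b[OF y] b0_closed[OF x] b0_closed[OF y]
          H.triangle[of "b0 (trunc m x)" "b0 (trunc m y)" "b y"] H.commute[of "b x" "b0 (trunc m x)"]
        by fastforce
    qed
  qed
  then have "hoelder_continuous G S A d b"
    unfolding hoelder_continuous_def using C by blast
  moreover have "c h x = inv\<^bsub>H\<^esub> b (shift G h x) \<otimes>\<^bsub>H\<^esub> \<phi> h \<otimes>\<^bsub>H\<^esub> b x"
    if h: "h \<in> carrier G" and x: "x \<in> X" for h x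
  proof -
    have hx: "shift G h x \<in> X" using shift_closed h x by blast
    obtain C' r' where C': "0 < C'" "0 < r'" "r' < 1" and c_le:
      "\<And>n x y. \<lbrakk>x \<in> X; y \<in> X; \<forall>q\<in>word_ball G S n. x q = y q\<rbrakk> \<Longrightarrow> d (c h x) (c h y) \<le> C' * r' ^ n"
      using c_hoelder[OF h] unfolding hoelder_continuous_def by blast
    let ?x = "\<lambda>n. trunc n x"
    let ?hx = "\<lambda>n. shift G h (trunc n x)"
    \<comment> \<open>The error terms are, in order: replacing \<open>x\<close> by its truncation in
      \<open>c h\<close>, exchanging truncation and shift, and the convergence of \<open>b0\<close>
      to \<open>b\<close> at the shifted and at the original configuration.\<close>
    let ?f = "\<lambda>n. C' * r' ^ n + ((C * r ^ (n - len h) + d (b0 (trunc n (shift G h x))) (b (shift G h x)))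
                 + d (b0 (?x n)) (b x))"
    show ?thesis
    proof (rule H.limit_unique[OF sequentially_bot])
      have pow: "(\<lambda>n. r ^ (n - len h)) \<longlonglongrightarrow> 0"
        by (rule LIMSEQ_offset[where k = "len h"]) (use C LIMSEQ_realpow_zero[of r] in simp)
      have "?f \<longlonglongrightarrow> C' * 0 + ((C * 0 + 0) + 0)"
        using C' by (intro tendsto_intros lim pow x hx LIMSEQ_realpow_zero) auto
      then show "?f \<longlonglongrightarrow> 0" by simp
      show "eventually (\<lambda>n. d (c h x) (inv\<^bsub>H\<^esub> b (shift G h x) \<otimes>\<^bsub>H\<^esub> \<phi> h \<otimes>\<^bsub>H\<^esub> b x) \<le> ?f n) sequentially"
        using eventually_ge_at_top[of "len h"]
      proof eventually_elim
        case (elim n)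
        have hom: "homoclinic (?x n)" "homoclinic (?hx n)" "homoclinic (trunc n (shift G h x))"
          using homoclinic_trunc homoclinic_shift x hx h by blast+
        \<comment> \<open>Shifting a truncation and truncating a shift agree only up to radius
          \<open>n - len h\<close>, as \<open>h\<close> moves positions by at most its
          length.\<close>
        have "d (b0 (?hx n)) (b0 (trunc n (shift G h x))) \<le> C * r ^ (n - len h)"
        proof (rule le[OF hom(2,3)], rule ballI)
          fix q assume "q \<in> word_ball G S (n - len h)"
          then have q: "q \<in> carrier G" "len q \<le> n - len h" by (auto simp: word_ball_def)
          then have "len (inv\<^bsub>G\<^esub> h \<otimes>\<^bsub>G\<^esub> q) \<le> n"
            using word_length_mult_le[of "inv\<^bsub>G\<^esub> h" q] h elim by (simp add: word_length_inv)
          with q h show "?hx n q = trunc n (shift G h x) q"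
            by (simp add: shift_apply trunc_apply)
        qed
        then have 1: "d (b0 (?hx n)) (b (shift G h x))
            \<le> C * r ^ (n - len h) + d (b0 (trunc n (shift G h x))) (b (shift G h x))"
          using H.triangle[of "b0 (?hx n)" "b0 (trunc n (shift G h x))" "b (shift G h x)"]
            b[OF hx] b0(1)[OF hom(2)] b0(1)[OF hom(3)] by linarith
        have 2: "d (c h x) (c h (?x n)) \<le> C' * r' ^ n"
          by (rule c_le) (use x trunc_in_X in \<open>auto simp: word_ball_def trunc_apply\<close>)
        have closed: "c h x \<in> carrier H" "c h (?x n) \<in> carrier H" "\<phi> h \<in> carrier H" "b0 (?hx n) \<in> carrier H"
          "b0 (?x n) \<in> carrier H" "b x \<in> carrier H" "b (shift G h x) \<in> carrier H"
          using h x hx trunc_in_X b b0(1) hom by auto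
        let ?y = "inv\<^bsub>H\<^esub> b (shift G h x) \<otimes>\<^bsub>H\<^esub> \<phi> h \<otimes>\<^bsub>H\<^esub> b x"
        have "d (c h (?x n)) ?y
            \<le> d (inv\<^bsub>H\<^esub> b0 (?hx n) \<otimes>\<^bsub>H\<^esub> \<phi> h) (inv\<^bsub>H\<^esub> b (shift G h x) \<otimes>\<^bsub>H\<^esub> \<phi> h) + d (b0 (?x n)) (b x)"
          unfolding b0_shift[OF hom(1) h] using closed by (intro H.dist_mult_le) auto
        also have "\<dots> = d (b0 (?hx n)) (b (shift G h x)) + d (b0 (?x n)) (b x)"
          using closed by (simp add: H.right_invariant H.dist_inv)
        finally show ?case
          using 1 2 H.triangle[of "c h x" "c h (?x n)" ?y] closed by simp
      qed
    qed (use b h x hx in auto)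
  qed
  ultimately show ?thesis
    using b unfolding hoelder_cohomologous_def by blast
qed

end

section \<open>Membership in the class of Hoelder rigid groups\<close>

theorem mainTheorem3:
  fixes G :: "('g, 'm) monoid_scheme" and S :: "'g set"
  assumes "group G"
    and "finite_symmetric_generating_set G S"
    and "wide G S"
    and "\<exists>g\<in>carrier G. undistorted G S g"
  shows "hoelder_rigid_class TYPE('a) TYPE('h) G S"
  unfolding hoelder_rigid_class_def
proof (intro allI impI, elim conjE)
  fix A :: "'a set" and H :: "'h monoid" and T d c
  assume polish: "polish_group H T" and metric: "compatible_biinvariant_metric H T d"
    and complete: "Metric_space.mcomplete (carrier H) d" and hoelder: "hoelder_cocycle G S A H d c"
  interpret G: word_data G S
    using assms by (simp add: word_data_def word_data_axioms_def)
  interpret H: group H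
    using polish by (simp add: polish_group_def)
  show "\<exists>\<phi>\<in>hom G H. hoelder_cohomologous G S A H d c (\<lambda>g x. \<phi> g)"
  \<comment> \<open>An empty alphabet provides no constant configuration, but then there are no
    configurations at all and the trivial homomorphism serves.\<close>
  proof (cases "A = {}")
    case True
    then have "full_shift G A = {}"
      using G.one_closed by (auto simp: full_shift_def PiE_eq_empty_iff)
    then have "hoelder_cohomologous G S A H d c (\<lambda>g x. \<one>\<^bsub>H\<^esub>)"
      by (auto simp: hoelder_cohomologous_def hoelder_continuous_def intro!: exI[of _ 1] exI[of _ "1/2"])
    then show ?thesis
      by (intro bexI[of _ "\<lambda>_. \<one>\<^bsub>H\<^esub>"]) (auto simp: hom_def)
  next
    case False
    then obtain a0 where a0: "a0 \<in> A" by blast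
    obtain g where g: "g \<in> carrier G" "undistorted G S g"
      using assms(4) by blast
    obtain l where l: "0 < l" "\<And>n. l * real n \<le> word_length G S (g [^]\<^bsub>G\<^esub> n)"
      using G.undistorted_lower_bound[OF g(2,1)] by blast
    obtain \<omega> :: "nat filter" where \<omega>: "nonprincipal_ultrafilter \<omega>"
      using ex_nonprincipal_ultrafilter by blast
    have "biinvariant_group H d"
      using metric H.is_group
      by (simp add: biinvariant_group_def biinvariant_group_axioms_def compatible_biinvariant_metric_def)
    then interpret wide_shift_cocycle G S H d A c a0 g l \<omega>
      using G.word_data_axioms complete hoelder a0 assms(3) g(1) l \<omega>
      by (simp add: wide_shift_cocycle_def wide_shift_cocycle_axioms_def shift_cocycle_def shift_cocycle_axioms_def)
    show ?thesis
      using \<phi>_hom cohomologous_to_hom by blast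
  qed
qed

end
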